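(* Let $n_1,n_2,n_3,n_4\in\mathbb{N}_0$ with $n_1\ge 1$ or $n_3\ge 1$. Let real numbers be given such that $$a_j>0,\ b_j\ge 0\quad (1\le j\le n_1),$$ $$a'_j>0,\ c_j\ge 0,\ d_j\ge c_j+1\quad (1\le j\le n_2),$$ $$a''_j>0,\ r_j>0,\ o_j\ge 0\quad (1\le j\le n_3),$$ $$a'''_j>0,\ v_j>0,\ w_j\ge v_j+1\quad (1\le j\le n_4).$$ Set $m'=n_1+n_2+n_3$, $n'=n_3+n_4$, $p'=n_2+n_3+n_4$, $q'=n_1+n_2+n_3+n_4$, and define the ordered lists $$(\alpha'_j,A'_j)_1^{p'}=(1-r_j,a''_j)_1^{n_3},\,(1-v_j,a'''_j)_1^{n_4},\,(d_j,a'_j)_1^{n_2},$$ $$(\beta'_j,B'_j)_1^{q'}=(b_j,a_j)_1^{n_1},\,(c_j,a'_j)_1^{n_2},\,(o_j,a''_j)_1^{n_3},\,(1-w_j,a'''_j)_1^{n_4}.$$ Assume moreover that $A'_j(\beta'_{j'}+l)\ne B'_{j'}(\alpha'_j-l'-1)$ for all $j=1,\dots,n'$, $j'=1,\dots,m'$ and $l,l'\in\mathbb{N}_0$. Then $$H^{m',n'}_{p',q'}\left[t\,\Big|\begin{array}{c}(\alpha'_j,A'_j)_1^{p'}\\ (\beta'_j,B'_j)_1^{q'}\end{array}\right]>0\qquad\text{for every } t>0.$$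
   Context: $\mathbb{N}_0=\{0,1,2,\dots\}$. The notation $(x_j,X_j)_1^l$ stands for the list $(x_1,X_1),\dots,(x_l,X_l)$ (the empty list if $l=0$); lists separated by commas are concatenated. Fox $H$-function. For $0\le n\le p$, $0\le m\le q$, $A_j,B_j>0$, $\alpha_j,\beta_j\in\mathbb{C}$ with $A_j(l+\beta_{j'})\ne B_{j'}(\alpha_j-l'-1)$ for all $1\le j\le n$, $1\le j'\le m$, $l,l'\in\mathbb{N}_0$, put $$\Xi^{m,n}_{p,q}(s)=\frac{\prod_{j=1}^m\Gamma(\beta_j+B_js)\prod_{j=1}^n\Gamma(1-\alpha_j-A_js)}{\prod_{j=m+1}^q\Gamma(1-\beta_j-B_js)\prod_{j=n+1}^p\Gamma(\alpha_j+A_js)}$$ (empty products are $1$), and $$H^{m,n}_{p,q}\left[z\,\Big|\begin{array}{c}(\alpha_j,A_j)_1^p\\(\beta_j,B_j)_1^q\end{array}\right]=\frac{1}{2\pi i}\int_{\mathcal C}\Xi^{m,n}_{p,q}(s)\,z^{-s}\,ds .$$ Let $\chi=\sum_{j=1}^nA_j-\sum_{j=n+1}^pA_j+\sum_{j=1}^mB_j-\sum_{j=m+1}^qB_j$. When $\chi>0$ (as is the case here) and $z>0$, $\mathcal C$ is a contour going from $\gamma-i\infty$ to $\gamma+i\infty$ ($\gamma\in\mathbb{R}$), leaving all poles of $\Gamma(\beta_j+B_js)$, $1\le j\le m$, on its left and all poles of $\Gamma(1-\alpha_j-A_js)$, $1\le j\le n$, on its right; the integral converges and does not depend on the choice of such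 a contour. *)

theory Defs
  imports "HOL-Complex_Analysis.Complex_Analysis"
begin

text \<open>
  The upper parameters \<open>(\<alpha>\<^sub>j, A\<^sub>j)\<close> and the lower parameters \<open>(\<beta>\<^sub>j, B\<^sub>j)\<close> of the Fox H-function are
  given as lists \<open>us\<close> and \<open>ls\<close>, so \<open>p = length us\<close> and \<open>q = length ls\<close>. List indices start at 0:
  the usual range \<open>1 \<le> j \<le> m\<close> is \<open>j < m\<close> here.

  In HOL, \<open>Gamma\<close> is 0 at its poles and \<open>x / 0 = 0\<close>, so a pole of a factor of the denominator makes
  the quotient 0, as it should be. Poles of the numerator are excluded by the choice of the contour.
\<close>

type_synonym fox_params = "(complex \<times> real) list"

definition fox_Xi :: "nat \<Rightarrow> nat \<Rightarrow> fox_params \<Rightarrow> fox_params \<Rightarrow> complex \<Rightarrow> complex" where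
  "fox_Xi m n us ls s =
     ((\<Prod>j<m. Gamma (fst (ls ! j) + of_real (snd (ls ! j)) * s)) *
      (\<Prod>j<n. Gamma (1 - fst (us ! j) - of_real (snd (us ! j)) * s))) /
     ((\<Prod>j=m..<length ls. Gamma (1 - fst (ls ! j) - of_real (snd (ls ! j)) * s)) *
      (\<Prod>j=n..<length us. Gamma (fst (us ! j) + of_real (snd (us ! j)) * s)))"

text \<open>
  An unbounded contour is a parametrisation \<open>C\<close> by the whole real line; \<open>C \<circ> linepath S T\<close> is its
  part with parameters between \<open>S\<close> and \<open>T\<close>.
\<close>

definition contour_from_to_ii_infinity :: "real \<Rightarrow> (real \<Rightarrow> complex) \<Rightarrow> bool" where
  "contour_from_to_ii_infinity \<gamma> C \<longleftrightarrow>
     (\<forall>S T. C piecewise_C1_differentiable_on {S..T}) \<and> inj C \<and>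
     ((\<lambda>t. Re (C t)) \<longlongrightarrow> \<gamma>) at_bot \<and> filterlim (\<lambda>t. Im (C t)) at_bot at_bot \<and>
     ((\<lambda>t. Re (C t)) \<longlongrightarrow> \<gamma>) at_top \<and> filterlim (\<lambda>t. Im (C t)) at_top at_top"

text \<open>
  Sides of an upward contour: seen from a point on its left the argument increases by \<open>\<pi>\<close> in total
  along the contour, seen from a point on its right it decreases by \<open>\<pi>\<close>. For a non-closed path the
  real part of \<open>winding_number\<close> is the variation of the argument divided by \<open>2 * pi\<close>. Its imaginary
  part records the moduli at the two ends and carries no information here.
\<close>

definition left_of_contour :: "(real \<Rightarrow> complex) \<Rightarrow> complex \<Rightarrow> bool" where
  "left_of_contour C w \<longleftrightarrow> w \<notin> range C \<and>
     ((\<lambda>(S, T). Re (winding_number (C \<circ> linepath S T) w)) \<longlongrightarrow> 1 / 2) (at_bot \<times>\<^sub>F at_top)"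

definition right_of_contour :: "(real \<Rightarrow> complex) \<Rightarrow> complex \<Rightarrow> bool" where
  "right_of_contour C w \<longleftrightarrow> w \<notin> range C \<and>
     ((\<lambda>(S, T). Re (winding_number (C \<circ> linepath S T) w)) \<longlongrightarrow> - 1 / 2) (at_bot \<times>\<^sub>F at_top)"

definition fox_contour ::
    "nat \<Rightarrow> nat \<Rightarrow> fox_params \<Rightarrow> fox_params \<Rightarrow> (real \<Rightarrow> complex) \<Rightarrow> bool" where
  "fox_contour m n us ls C \<longleftrightarrow>
     (\<exists>\<gamma>. contour_from_to_ii_infinity \<gamma> C) \<and>
     (\<forall>j<m. \<forall>w. is_pole (\<lambda>s. Gamma (fst (ls ! j) + of_real (snd (ls ! j)) * s)) w
        \<longrightarrow> left_of_contour C w) \<and>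
     (\<forall>j<n. \<forall>w. is_pole (\<lambda>s. Gamma (1 - fst (us ! j) - of_real (snd (us ! j)) * s)) w
        \<longrightarrow> right_of_contour C w)"

text \<open>
  \<open>h\<close> is the value of the H-function if an admissible contour exists and the integral along every
  admissible contour converges, as an improper integral, to \<open>2 * pi * \<i> * h\<close>. This is the definition
  for positive \<open>z\<close> and positive \<open>\<chi>\<close>; other cases need other contours and are not covered. The
  function \<open>fox_H\<close> is only meaningful where such an \<open>h\<close> exists (it is then unique).
\<close>

definition has_fox_H ::
    "nat \<Rightarrow> nat \<Rightarrow> fox_params \<Rightarrow> fox_params \<Rightarrow> real \<Rightarrow> complex \<Rightarrow> bool" where
  "has_fox_H m n us ls z h \<longleftrightarrow>
     (\<exists>C. fox_contour m n us ls C) \<and>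
     (\<forall>C. fox_contour m n us ls C \<longrightarrow>
        ((\<lambda>(S, T). 1 / (2 * of_real pi * \<i>) *
            contour_integral (C \<circ> linepath S T) (\<lambda>s. fox_Xi m n us ls s * of_real z powr (- s)))
          \<longlongrightarrow> h) (at_bot \<times>\<^sub>F at_top))"

definition fox_H :: "nat \<Rightarrow> nat \<Rightarrow> fox_params \<Rightarrow> fox_params \<Rightarrow> real \<Rightarrow> complex" where
  "fox_H m n us ls z = (THE h. has_fox_H m n us ls z h)"

end

theory Submission
  imports Defs "HOL-Probability.Characteristic_Functions" "HOL-Probability.Sinc_Integral"
begin

text \<open>
  All poles are real, and a vertical line with small positive abscissa \<open>g\<close> separates them. An
  arbitrary admissible contour is closed up with two horizontal segments and a piece of this line.
  The winding numbers of the resulting loop around the finitely many poles in a strip containing it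
  are integers that tend to 0, and the integrand decays along the horizontal segments, so both
  contours give the same integral.

  On the line the integrand is, up to a positive factor, the Fourier kernel times a product of
  factors \<open>\<Gamma>(\<beta> + B s)\<close> and \<open>\<Gamma>(\<beta> + B s) / \<Gamma>(\<beta> + \<delta> + B s)\<close> with \<open>\<beta> + B g > 0\<close> and \<open>\<delta> > 0\<close>. By
  Euler's integrals each factor is the Fourier transform of a nonnegative function. Multiplication
  by such a factor convolves the Fourier transform with a positive measure and so preserves its
  strict positivity; the first factor, some \<open>\<Gamma>(\<beta> + B s)\<close> with \<open>B > 0\<close>, is integrable on the line
  and its Fourier transform is positive by Fourier inversion.
\<close>

section \<open>Euler's integrals\<close>

text \<open>Three points shape the proof. An admissible contour is known only through limits of
  winding numbers, so no region between it and the vertical line can be described; integrality of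
  winding numbers and the homology form of Cauchy's theorem replace the geometry.

  A quotient \<open>\<Gamma>(\<beta> + B s) / \<Gamma>(\<beta> + \<delta> + B s)\<close> decays on
  the line only like \<open>|y|\<close> to the power \<open>- \<delta>\<close>, and
  \<open>\<delta> = 1\<close> is allowed, so it need not be integrable there; moreover its density
  in the variable \<open>ln t\<close> lives on a half-line. Quotients therefore only act as
  multipliers. Integrability and strict positivity at every frequency have to start from a single
  Gamma factor, whose density is positive for every \<open>t > 0\<close>; this is where
  \<open>n1 \<ge> 1\<close> or \<open>n3 \<ge> 1\<close> enters.

  All estimates come from Euler's integrals and the recurrence: in the right half-plane the modulus
  is bounded by the value at the real part, and each step of the recurrence contributes one power of
  decay in the imaginary part.\<close>

definition gamma_weight :: "real \<Rightarrow> real \<Rightarrow> real" where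
  "gamma_weight \<kappa> t = indicator {0<..} t * (t powr (\<kappa> - 1) * exp (- t))"

definition beta_weight :: "real \<Rightarrow> real \<Rightarrow> real \<Rightarrow> real" where
  "beta_weight \<kappa> \<delta> t = indicator {0<..<1} t * (t powr (\<kappa> - 1) * (1 - t) powr (\<delta> - 1))"

lemma gamma_weight_nonneg: "gamma_weight \<kappa> t \<ge> 0"
  and beta_weight_nonneg: "beta_weight \<kappa> \<delta> t \<ge> 0"
  by (simp_all add: gamma_weight_def beta_weight_def)

lemma borel_measurable_gamma_weight [measurable]: "gamma_weight \<kappa> \<in> borel_measurable borel"
  and borel_measurable_beta_weight [measurable]: "beta_weight \<kappa> \<delta> \<in> borel_measurable borel"
  unfolding gamma_weight_def beta_weight_def by measurable

lemma borel_measurable_cis [measurable]: "cis \<in> borel_measurable borel"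
  by (intro borel_measurable_continuous_onI continuous_intros)

text \<open>Turns Mellin kernels into Fourier kernels: the imaginary part of the exponent becomes a
  frequency paired with \<open>ln t\<close>.\<close>

lemma powr_Complex_eq_cis:
  assumes "t > 0"
  shows "complex_of_real t powr Complex x y = of_real (t powr x) * cis (y * ln t)"
proof -
  have "Complex x y * of_real (ln t) = of_real (x * ln t) + \<i> * of_real (y * ln t)"
    by (simp add: complex_eq_iff)
  then show ?thesis
    using assms by (simp add: powr_def Ln_of_real exp_add cis_conv_exp exp_of_real[symmetric])
qed

lemma has_bochner_integral_Gamma:
  assumes "\<kappa> > 0"
  shows "has_bochner_integral lborel (\<lambda>t. complex_of_real (gamma_weight \<kappa> t) * cis (y * ln t))
           (Gamma (Complex \<kappa> y))"
proof -
  let ?g = "\<lambda>t. complex_of_real t powr (Complex \<kappa> y - 1) / of_real (exp t)"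
  let ?h = "\<lambda>t. complex_of_real (gamma_weight \<kappa> t) * cis (y * ln t)"
  have eq: "(\<lambda>t. indicator {0<..} t *\<^sub>R ?g t) = ?h"
  proof
    fix t :: real
    have "Complex \<kappa> y - 1 = Complex (\<kappa> - 1) y"
      by (simp add: complex_eq_iff)
    then show "indicator {0<..} t *\<^sub>R ?g t = ?h t"
      by (simp add: gamma_weight_def indicator_def powr_Complex_eq_cis exp_minus divide_inverse)
  qed
  \<comment> \<open>Absolute integrability identifies the gauge integral with the Lebesgue integral;
    Borel measurability then replaces \<open>lebesgue\<close> by \<open>lborel\<close>.\<close>
  have "?g absolutely_integrable_on {0<..}"
    using absolutely_integrable_Gamma_integral'[of "Complex \<kappa> y"] assms by simp
  moreover have "(?g has_integral Gamma (Complex \<kappa> y)) {0<..}"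
    using Gamma_integral_complex'[of "Complex \<kappa> y"] assms by simp
  ultimately have "integrable lebesgue ?h" "integral\<^sup>L lebesgue ?h = Gamma (Complex \<kappa> y)"
    using set_lebesgue_integral_eq_integral(2)[of "{0<..}" ?g]
    by (simp_all add: set_integrable_def set_lebesgue_integral_def eq integral_unique)
  moreover have "?h \<in> borel_measurable lborel"
    by measurable
  ultimately show ?thesis
    by (simp add: has_bochner_integral_iff integrable_completion integral_completion)
qed

lemma
  assumes "\<kappa> > 0"
  shows integrable_gamma_weight: "integrable lborel (gamma_weight \<kappa>)"
    and integral_gamma_weight: "integral\<^sup>L lborel (gamma_weight \<kappa>) = Gamma \<kappa>"
proof -
  have "has_bochner_integral lborel (\<lambda>t. complex_of_real (gamma_weight \<kappa> t)) (of_real (Gamma \<kappa>))"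
    using has_bochner_integral_Gamma[OF assms, of 0]
    by (simp add: complex_of_real_def[symmetric] Gamma_complex_of_real)
  then have "has_bochner_integral lborel (gamma_weight \<kappa>) (Gamma \<kappa>)"
    using has_bochner_integral_bounded_linear[OF bounded_linear_Re] by fastforce
  then show "integrable lborel (gamma_weight \<kappa>)" "integral\<^sup>L lborel (gamma_weight \<kappa>) = Gamma \<kappa>"
    by (simp_all add: has_bochner_integral_iff)
qed

text \<open>Triangle inequality in Euler's integral, whose density depends only on the real
  part.\<close>

lemma norm_Gamma_le:
  assumes "Re z > 0"
  shows "norm (Gamma z) \<le> Gamma (Re z)"
proof -
  have "Gamma z = (CLBINT t. of_real (gamma_weight (Re z) t) * cis (Im z * ln t))"
    using has_bochner_integral_Gamma[OF assms, of "Im z"] by (simp add: has_bochner_integral_iff)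
  also have "norm \<dots> \<le> (LBINT t. norm (complex_of_real (gamma_weight (Re z) t) * cis (Im z * ln t)))"
    by (rule integral_norm_bound)
  also have "\<dots> = Gamma (Re z)"
    using assms by (simp add: norm_mult gamma_weight_nonneg integral_gamma_weight)
  finally show ?thesis .
qed

lemma
  assumes "\<kappa> > 0" "\<delta> > 0"
  shows integrable_beta_weight: "integrable lborel (beta_weight \<kappa> \<delta>)"
    and integral_beta_weight: "integral\<^sup>L lborel (beta_weight \<kappa> \<delta>) = Beta \<kappa> \<delta>"
proof -
  let ?f = "\<lambda>t. t powr (\<kappa> - 1) * (1 - t) powr (\<delta> - 1)"
  \<comment> \<open>The endpoints agree because \<open>0 powr x = 0\<close>.\<close>
  have eq: "indicator {0..1} t *\<^sub>R ?f t = beta_weight \<kappa> \<delta> t" for t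
    by (auto simp: beta_weight_def indicator_def)
  have si: "set_integrable lborel {0..1} ?f"
    using assms by (rule integrable_Beta)
  then show "integrable lborel (beta_weight \<kappa> \<delta>)"
    unfolding set_integrable_def eq .
  have "(LINT t:{0..1}|lborel. ?f t) = Beta \<kappa> \<delta>"
    using set_borel_integral_eq_integral(2)[OF si] has_integral_Beta_real[OF assms] by (simp add: integral_unique)
  then show "integral\<^sup>L lborel (beta_weight \<kappa> \<delta>) = Beta \<kappa> \<delta>"
    unfolding set_lebesgue_integral_def eq .
qed

text \<open>Euler's double integral: \<open>?F s x\<close> is the product of two Gamma integrands at
  \<open>s\<close> and \<open>x - s\<close>. Integrating over \<open>x\<close> first splits off
  \<open>Gamma \<delta>\<close>; integrating over \<open>s\<close> first, with
  \<open>s = x * t\<close>, separates the Gamma integrand at \<open>x\<close> from the Beta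
  integrand at \<open>t\<close>.\<close>

lemma Gamma_mult_eq_Beta_integral:
  assumes "\<kappa> > 0" "\<delta> > 0"
  shows "Gamma (Complex \<kappa> y) * Gamma (of_real \<delta>) =
    Gamma (Complex (\<kappa> + \<delta>) y) * (CLBINT t. of_real (beta_weight \<kappa> \<delta> t) * cis (y * ln t))"
proof -
  let ?F = "\<lambda>s x. complex_of_real (gamma_weight \<kappa> s) * cis (y * ln s) * of_real (gamma_weight \<delta> (x - s))"
  let ?B = "CLBINT t. of_real (beta_weight \<kappa> \<delta> t) * cis (y * ln t)"
  have shift: "has_bochner_integral lborel (\<lambda>x. gamma_weight \<delta> (x - s)) (Gamma \<delta>)" for s
  proof -
    have "has_bochner_integral lborel (gamma_weight \<delta>) (Gamma \<delta>)"
      using assms by (simp add: has_bochner_integral_iff integrable_gamma_weight integral_gamma_weight)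
    from lborel_has_bochner_integral_real_affine_iff[of 1 "gamma_weight \<delta>" "Gamma \<delta>" "-s", THEN iffD1, OF _ this]
    show ?thesis by (simp add: algebra_simps)
  qed
  have inner_int: "integrable lborel (?F s)" for s
    using shift by (auto simp: has_bochner_integral_iff)
  have meas: "case_prod ?F \<in> borel_measurable (lborel \<Otimes>\<^sub>M lborel)"
    by measurable
  have int: "integrable (lborel \<Otimes>\<^sub>M lborel) (case_prod ?F)"
  proof (rule lborel_pair.Fubini_integrable)
    have "(LBINT x. norm (case_prod ?F (s, x))) = gamma_weight \<kappa> s * Gamma \<delta>" for s
      using shift[of s] by (simp add: norm_mult gamma_weight_nonneg has_bochner_integral_iff)
    then show "integrable lborel (\<lambda>s. LBINT x. norm (case_prod ?F (s, x)))"
      using assms by (simp add: integrable_gamma_weight)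
  qed (use meas inner_int in auto)
  have row: "(CLBINT s. ?F s x) = of_real (gamma_weight (\<kappa> + \<delta>) x) * cis (y * ln x) * ?B" for x
  proof (cases "x > 0")
    case True
    have "(CLBINT s. ?F s x) = \<bar>x\<bar> *\<^sub>R (CLBINT t. ?F (0 + x * t) x)"
      using True by (intro lborel_integral_real_affine) auto
    also have "\<dots> = (CLBINT t. x *\<^sub>R ?F (x * t) x)"
      using True by simp
    also have "\<dots> = (CLBINT t. of_real (gamma_weight (\<kappa> + \<delta>) x) * cis (y * ln x) *
                       (of_real (beta_weight \<kappa> \<delta> t) * cis (y * ln t)))"
    proof (intro Bochner_Integration.integral_cong refl)
      fix t :: real
      show "x *\<^sub>R ?F (x * t) x = of_real (gamma_weight (\<kappa> + \<delta>) x) * cis (y * ln x) *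
                       (of_real (beta_weight \<kappa> \<delta> t) * cis (y * ln t))"
      proof (cases "0 < t \<and> t < 1")
        case t: True
        have pos: "x * t > 0" "x * (1 - t) > 0" and eq: "x - x * t = x * (1 - t)"
          using True t by (simp_all add: algebra_simps)
        have p: "x * (x powr (\<kappa> - 1) * x powr (\<delta> - 1)) = x powr (\<kappa> + \<delta> - 1)"
          using True by (simp add: powr_add[symmetric] powr_mult_base)
        have e: "exp (- (x * t)) * exp (- (x * (1 - t))) = exp (- x)"
          by (simp add: exp_add[symmetric] algebra_simps)
        have "x * (gamma_weight \<kappa> (x * t) * gamma_weight \<delta> (x * (1 - t))) =
            (x * (x powr (\<kappa> - 1) * x powr (\<delta> - 1))) *
            (exp (- (x * t)) * exp (- (x * (1 - t)))) * beta_weight \<kappa> \<delta> t"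
          using True t pos unfolding gamma_weight_def beta_weight_def
          by (simp add: powr_mult mult_ac)
        then have "x * (gamma_weight \<kappa> (x * t) * gamma_weight \<delta> (x - x * t))
            = gamma_weight (\<kappa> + \<delta>) x * beta_weight \<kappa> \<delta> t"
          unfolding p e eq using True by (simp add: gamma_weight_def)
        moreover have "cis (y * ln (x * t)) = cis (y * ln x) * cis (y * ln t)"
          using True t by (simp add: ln_mult cis_mult algebra_simps)
        moreover have "x *\<^sub>R ?F (x * t) x =
            of_real (x * (gamma_weight \<kappa> (x * t) * gamma_weight \<delta> (x - x * t))) * cis (y * ln (x * t))"
          by (simp add: scaleR_conv_of_real mult_ac)
        ultimately show ?thesis
          by (simp add: mult_ac)
      next
        \<comment> \<open>Now \<open>x * t \<le> 0\<close> or \<open>x - x * t \<le> 0\<close>, so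
          one of the two Gamma weights vanishes.\<close>
        case False
        then have "gamma_weight \<kappa> (x * t) * gamma_weight \<delta> (x - x * t) = 0"
          using True by (auto simp: gamma_weight_def indicator_def not_less zero_less_mult_iff)
        then show ?thesis
          using False by (auto simp: beta_weight_def indicator_def)
      qed
    qed
    finally show ?thesis by simp
  next
    case False
    then have zero: "?F s x = 0" for s
      by (auto simp: gamma_weight_def indicator_def)
    show ?thesis unfolding zero
      using False by (simp add: gamma_weight_def indicator_def)
  qed
  have "Gamma (Complex \<kappa> y) * Gamma (of_real \<delta>) = (CLBINT s. of_real (gamma_weight \<kappa> s) * cis (y * ln s)) * Gamma (of_real \<delta>)"
    using has_bochner_integral_Gamma[of \<kappa> y] assms by (simp add: has_bochner_integral_iff)
  also have "\<dots> = (CLBINT s. CLBINT x. ?F s x)"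
    using shift by (simp add: has_bochner_integral_iff Gamma_complex_of_real)
  also have "\<dots> = (CLBINT x. CLBINT s. ?F s x)"
    using lborel_pair.Fubini_integral[OF int] by simp
  also have "\<dots> = Gamma (Complex (\<kappa> + \<delta>) y) * ?B"
    using has_bochner_integral_Gamma[of "\<kappa> + \<delta>" y] assms by (simp add: row has_bochner_integral_iff)
  finally show ?thesis .
qed

lemma Gamma_ratio_eq_integral:
  assumes "\<kappa> > 0" "\<delta> > 0"
  shows "Gamma (Complex \<kappa> y) * rGamma (Complex (\<kappa> + \<delta>) y) =
    (CLBINT t. of_real (beta_weight \<kappa> \<delta> t / Gamma \<delta>) * cis (y * ln t))"
proof -
  \<comment> \<open>In HOL \<open>Gamma\<close> is zero exactly at its poles, and these have
    nonpositive real part.\<close>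
  have "Gamma (Complex (\<kappa> + \<delta>) y) \<noteq> 0"
    using assms by (auto simp: Gamma_eq_zero_iff Complex_eq elim!: nonpos_Ints_cases dest: arg_cong[of _ _ Re])
  moreover have "Gamma \<delta> \<noteq> 0"
    using Gamma_real_pos[OF assms(2)] by simp
  ultimately show ?thesis
    using Gamma_mult_eq_Beta_integral[OF assms, of y] assms
    by (simp add: rGamma_inverse_Gamma Gamma_complex_of_real field_simps)
qed

text \<open>The density for \<open>z\<close> depends only on \<open>Re z\<close>, so its total mass,
  which is the value of the quotient at \<open>Re z\<close>, is a bound.\<close>

lemma norm_Gamma_ratio_le:
  assumes "Re z > 0" "\<delta> > 0"
  shows "norm (Gamma z * rGamma (z + of_real \<delta>)) \<le> Gamma (Re z) / Gamma (Re z + \<delta>)"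
proof -
  have "z + of_real \<delta> = Complex (Re z + \<delta>) (Im z)"
    by (simp add: complex_eq_iff)
  then have "Gamma z * rGamma (z + of_real \<delta>) =
      (CLBINT t. of_real (beta_weight (Re z) \<delta> t / Gamma \<delta>) * cis (Im z * ln t))"
    using Gamma_ratio_eq_integral[OF assms, of "Im z"] by simp
  also have "norm \<dots> \<le> (LBINT t. norm (complex_of_real (beta_weight (Re z) \<delta> t / Gamma \<delta>) * cis (Im z * ln t)))"
    by (rule integral_norm_bound)
  also have "\<dots> = (LBINT t. beta_weight (Re z) \<delta> t / Gamma \<delta>)"
    using assms Gamma_real_pos[OF assms(2)] by (simp add: norm_mult norm_divide beta_weight_nonneg)
  also have "\<dots> = Gamma (Re z) / Gamma (Re z + \<delta>)"
    using assms Gamma_real_pos[OF assms(2)] by (simp add: integral_beta_weight Beta_def less_imp_neq[symmetric])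
  finally show ?thesis .
qed

section \<open>Positive Fourier transforms\<close>

text \<open>\<open>u\<close> will be \<open>ln z\<close>; the sign in \<open>cis\<close> is that of
  \<open>z powr (- s)\<close> on a vertical line. Positivity is demanded at every \<open>u\<close>,
  which is what survives averaging over shifts.\<close>

definition fourier_pos :: "(real \<Rightarrow> complex) \<Rightarrow> bool" where
  "fourier_pos f \<longleftrightarrow> integrable lborel f \<and>
     (\<forall>u. (CLBINT y. f y * cis (- (y * u))) \<in> \<real> \<and> Re (CLBINT y. f y * cis (- (y * u))) > 0)"

text \<open>Interchanging the integrals turns the new transform into the integral of the shifted
  values \<open>R (u - \<phi> x)\<close> with weight \<open>k x\<close>. The general
  \<open>\<phi>\<close> lets the Euler densities stay in their own variable, with
  \<open>\<phi> x = B * ln x\<close>, so that no substitution to the logarithmic scale is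
  needed.\<close>

lemma fourier_pos_mult:
  assumes f: "fourier_pos f"
    and [measurable]: "\<phi> \<in> borel_measurable borel"
    and k: "integrable lborel k" "\<And>x. k x \<ge> 0" "integral\<^sup>L lborel k > 0"
  shows "fourier_pos (\<lambda>y. f y * (CLBINT x. of_real (k x) * cis (y * \<phi> x)))"
proof -
  let ?g = "\<lambda>y. CLBINT x. complex_of_real (k x) * cis (y * \<phi> x)"
  define R where "R u = Re (CLBINT y. f y * cis (- (y * u)))" for u
  have [measurable]: "f \<in> borel_measurable borel" "k \<in> borel_measurable borel"
    and fint: "integrable lborel f"
    using f k by (auto simp: fourier_pos_def)
  have R: "(CLBINT y. f y * cis (- (y * u))) = of_real (R u)" "R u > 0" for u
    using f by (auto simp: fourier_pos_def R_def)
  have [measurable]: "R \<in> borel_measurable borel"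
    unfolding R_def by measurable
  have [measurable]: "?g \<in> borel_measurable borel"
    by measurable
  have gbound: "norm (?g y) \<le> integral\<^sup>L lborel k" for y
    using integral_norm_bound[of lborel "\<lambda>x. complex_of_real (k x) * cis (y * \<phi> x)"] k(2)
    by (simp add: norm_mult)
  have int: "integrable lborel (\<lambda>y. f y * ?g y)"
  proof (rule Bochner_Integration.integrable_bound)
    show "integrable lborel (\<lambda>y. integral\<^sup>L lborel k *\<^sub>R f y)"
      using fint by simp
    show "AE y in lborel. norm (f y * ?g y) \<le> norm (integral\<^sup>L lborel k *\<^sub>R f y)"
      using mult_left_mono[OF gbound norm_ge_zero] k(3)
      by (intro AE_I2) (simp add: norm_mult mult.commute[of "integral\<^sup>L lborel k"])
  qed measurable
  have "(CLBINT y. f y * ?g y * cis (- (y * u))) = of_real (LBINT x. k x * R (u - \<phi> x))"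
    and "(LBINT x. k x * R (u - \<phi> x)) > 0" for u
  proof -
    let ?F = "\<lambda>y x. f y * complex_of_real (k x) * cis (- (y * (u - \<phi> x)))"
    have cis_eq: "cis (- (y * (u - \<phi> x))) = cis (y * \<phi> x) * cis (- (y * u))" for x y
      by (simp add: cis_mult algebra_simps)
    have Fint: "integrable (lborel \<Otimes>\<^sub>M lborel) (case_prod ?F)"
    proof (rule lborel_pair.Fubini_integrable)
      have "(LBINT x. norm (case_prod ?F (y, x))) = norm (f y) * integral\<^sup>L lborel k" for y
        using k(2) by (simp add: norm_mult)
      then show "integrable lborel (\<lambda>y. LBINT x. norm (case_prod ?F (y, x)))"
        using fint by simp
      have "integrable lborel (\<lambda>x. ?F y x)" for y
      proof (rule Bochner_Integration.integrable_bound)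
        show "integrable lborel (\<lambda>x. norm (f y) * k x)"
          using k by simp
        show "AE x in lborel. norm (?F y x) \<le> norm (norm (f y) * k x)"
          using k(2) by (simp add: norm_mult)
      qed measurable
      then show "AE y in lborel. integrable lborel (\<lambda>x. case_prod ?F (y, x))"
        by simp
    qed measurable
    have "(CLBINT y. f y * ?g y * cis (- (y * u))) = (CLBINT y. CLBINT x. ?F y x)"
    proof (intro Bochner_Integration.integral_cong refl)
      fix y
      have "(CLBINT x. ?F y x) = (CLBINT x. (f y * cis (- (y * u))) * (complex_of_real (k x) * cis (y * \<phi> x)))"
        unfolding cis_eq by (simp add: mult_ac)
      then show "f y * ?g y * cis (- (y * u)) = (CLBINT x. ?F y x)"
        by simp
    qed
    also have "\<dots> = (CLBINT x. CLBINT y. ?F y x)"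
      using lborel_pair.Fubini_integral[OF Fint] by simp
    also have "\<dots> = (CLBINT x. of_real (k x) * (CLBINT y. f y * cis (- (y * (u - \<phi> x)))))"
      by (simp flip: integral_mult_right_zero add: mult_ac)
    also have "\<dots> = (CLBINT x. of_real (k x * R (u - \<phi> x)))"
      by (simp add: R)
    also have "\<dots> = of_real (LBINT x. k x * R (u - \<phi> x))"
      by (rule integral_complex_of_real)
    finally show "(CLBINT y. f y * ?g y * cis (- (y * u))) = of_real (LBINT x. k x * R (u - \<phi> x))" .
    \<comment> \<open>A Fourier transform is bounded by the L1 norm; this makes
      \<open>k x * R (u - \<phi> x)\<close> integrable.\<close>
    have Rbound: "norm (R u) \<le> (LBINT y. norm (f y))" for u
    proof -
      have "norm (R u) = norm (CLBINT y. f y * cis (- (y * u)))"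
        using R by simp
      also have "\<dots> \<le> (LBINT y. norm (f y * cis (- (y * u))))"
        by (rule integral_norm_bound)
      finally show ?thesis by (simp add: norm_mult)
    qed
    have kRint: "integrable lborel (\<lambda>x. k x * R (u - \<phi> x))"
    proof (rule Bochner_Integration.integrable_bound)
      show "integrable lborel (\<lambda>x. k x * (LBINT y. norm (f y)))"
        using k by simp
      have "norm (k x * R (u - \<phi> x)) \<le> norm (k x * (LBINT y. norm (f y)))" for x
        using mult_left_mono[OF Rbound[of "u - \<phi> x"] k(2)[of x]] k(2)[of x] by (simp add: abs_mult)
      then show "AE x in lborel. norm (k x * R (u - \<phi> x)) \<le> norm (k x * (LBINT y. norm (f y)))"
        by simp
    qed measurable
    have nonneg: "k x * R (u - \<phi> x) \<ge> 0" for x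
      using k(2) R(2) by (simp add: less_imp_le)
    \<comment> \<open>\<open>R\<close> is positive everywhere, so a zero integral would force
      \<open>k\<close> to vanish almost everywhere and hence to have mass 0.\<close>
    have "(LBINT x. k x * R (u - \<phi> x)) \<noteq> 0"
    proof
      assume "(LBINT x. k x * R (u - \<phi> x)) = 0"
      then have "AE x in lborel. k x * R (u - \<phi> x) = 0"
        using integral_nonneg_eq_0_iff_AE[OF kRint] nonneg by simp
      then have "AE x in lborel. k x = 0"
        by eventually_elim (use R(2) in \<open>simp add: less_imp_neq[symmetric]\<close>)
      then have "integral\<^sup>L lborel k = 0"
        using integral_nonneg_eq_0_iff_AE[OF k(1)] k(2) by simp
      then show False using k(3) by simp
    qed
    moreover have "(LBINT x. k x * R (u - \<phi> x)) \<ge> 0"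
      using nonneg by simp
    ultimately show "(LBINT x. k x * R (u - \<phi> x)) > 0" by simp
  qed
  then show ?thesis
    using int by (auto simp: fourier_pos_def)
qed

section \<open>A single Gamma factor by Gaussian regularisation\<close>

text \<open>The characteristic function of the standard normal distribution after the substitution
  \<open>x = \<sigma> * y\<close>. The value is \<open>2 * pi\<close> times the centred normal
  density with standard deviation \<open>\<sigma>\<close> at \<open>w\<close>, hence positive and
  concentrated at 0 for small \<open>\<sigma>\<close>.\<close>

lemma has_bochner_integral_gaussian:
  assumes "\<sigma> > 0"
  shows "has_bochner_integral lborel (\<lambda>y. of_real (exp (- (\<sigma> * y)\<^sup>2 / 2)) * cis (- (y * w)))
           (of_real (sqrt (2 * pi) / \<sigma> * exp (- (w / \<sigma>)\<^sup>2 / 2)) :: complex)"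
proof -
  let ?h = "\<lambda>x. complex_of_real (exp (- x\<^sup>2 / 2)) * cis (- (x * (w / \<sigma>)))"
  have eq: "std_normal_density x *\<^sub>R iexp (- (w / \<sigma>) * x) = ?h x / of_real (sqrt (2 * pi))" for x
    by (simp add: std_normal_density_def cis_conv_exp scaleR_conv_of_real field_simps)
  have "integrable std_normal_distribution (\<lambda>x. iexp (- (w / \<sigma>) * x))"
    using real_dist_normal_dist real_distribution.axioms(1) prob_space.finite_measure by (auto intro!: finite_measure.integrable_const_bound[where B=1])
  then have "integrable lborel (\<lambda>x. ?h x / of_real (sqrt (2 * pi)))"
    by (subst (asm) integrable_density) (simp_all only: eq, auto)
  moreover have "(CLBINT x. ?h x / of_real (sqrt (2 * pi))) = of_real (exp (- (w / \<sigma>)\<^sup>2 / 2))"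
  proof -
    have "(CLBINT x. ?h x / of_real (sqrt (2 * pi))) = char std_normal_distribution (- (w / \<sigma>))"
      unfolding char_def by (subst integral_density) (simp_all only: eq, auto)
    then show ?thesis by (simp add: char_std_normal_distribution)
  qed
  ultimately have "has_bochner_integral lborel (\<lambda>x. ?h x / of_real (sqrt (2 * pi))) (of_real (exp (- (w / \<sigma>)\<^sup>2 / 2)))"
    by (simp add: has_bochner_integral_iff)
  then have "has_bochner_integral lborel (\<lambda>x. ?h x / of_real (sqrt (2 * pi)) * of_real (sqrt (2 * pi)))
               (of_real (exp (- (w / \<sigma>)\<^sup>2 / 2)) * of_real (sqrt (2 * pi)))"
    by (rule has_bochner_integral_mult_left)
  then have "has_bochner_integral lborel ?h (of_real (sqrt (2 * pi) * exp (- (w / \<sigma>)\<^sup>2 / 2)))"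
    by (simp add: mult_ac)
  from lborel_has_bochner_integral_real_affine_iff[of \<sigma> ?h _ 0, THEN iffD1, OF _ this] assms
  show ?thesis
    by (simp add: scaleR_conv_of_real field_simps)
qed

text \<open>\<open>Gamma z * z * (z + 1) = Gamma (z + 2)\<close> is bounded on the line, so Gamma
  decays there like an inverse square. One step of the recurrence would only give
  \<open>1 / |y|\<close>, which is not integrable.\<close>

lemma Gamma_vertical_integrable:
  assumes "\<kappa> > 0" "B \<noteq> 0"
  shows "integrable lborel (\<lambda>y. Gamma (Complex \<kappa> (B * y)))"
proof (rule Bochner_Integration.integrable_bound)
  have "integrable lborel (\<lambda>x::real. inverse (1 + x\<^sup>2))"
    using integrable_inverse_1_plus_square by (simp add: set_integrable_def)
  then have "integrable lborel (\<lambda>y. inverse (1 + (0 + B * y)\<^sup>2))"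
    using lborel_integrable_real_affine_iff[OF assms(2), of "\<lambda>x. inverse (1 + x\<^sup>2)" 0] by simp
  then show "integrable lborel (\<lambda>y. (Gamma \<kappa> + Gamma (\<kappa> + 2)) * inverse (1 + (B * y)\<^sup>2))"
    by simp
  have "(\<lambda>y. Gamma (Complex \<kappa> (B * y))) = (\<lambda>y. CLBINT t. of_real (gamma_weight \<kappa> t) * cis (B * y * ln t))"
    using has_bochner_integral_Gamma[OF assms(1)] by (simp add: has_bochner_integral_iff)
  also have "\<dots> \<in> borel_measurable lborel"
    by measurable
  finally show "(\<lambda>y. Gamma (Complex \<kappa> (B * y))) \<in> borel_measurable lborel" .
  have "norm (Gamma (Complex \<kappa> y)) \<le> (Gamma \<kappa> + Gamma (\<kappa> + 2)) * inverse (1 + y\<^sup>2)" for y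
  proof -
    let ?z = "Complex \<kappa> y"
    have nz: "?z \<notin> \<int>\<^sub>\<le>\<^sub>0" "?z + 1 \<notin> \<int>\<^sub>\<le>\<^sub>0"
      using assms by (auto simp: Complex_eq elim!: nonpos_Ints_cases dest: arg_cong[of _ _ Re])
    have "Gamma (?z + 2) = Gamma (?z + 1 + 1)"
      by (simp add: add.assoc)
    also have "\<dots> = (?z + 1) * (?z * Gamma ?z)"
      by (simp only: Gamma_plus1[OF nz(1)] Gamma_plus1[OF nz(2)])
    finally have "norm (Gamma ?z) * (norm (?z + 1) * norm ?z) = norm (Gamma (?z + 2))"
      by (simp add: norm_mult mult_ac)
    also have "\<dots> \<le> Gamma (\<kappa> + 2)"
      using norm_Gamma_le[of "?z + 2"] assms by simp
    finally have 1: "norm (Gamma ?z) * (norm (?z + 1) * norm ?z) \<le> Gamma (\<kappa> + 2)" .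
    have "y\<^sup>2 \<le> norm (?z + 1) * norm ?z"
      using mult_mono[of "\<bar>y\<bar>" "norm (?z + 1)" "\<bar>y\<bar>" "norm ?z"] abs_Im_le_cmod[of "?z + 1"] abs_Im_le_cmod[of ?z]
      by (simp add: power2_eq_square)
    then have "norm (Gamma ?z) * y\<^sup>2 \<le> Gamma (\<kappa> + 2)"
      using 1 by (meson mult_left_mono norm_ge_zero order_trans)
    moreover have "norm (Gamma ?z) \<le> Gamma \<kappa>"
      using norm_Gamma_le[of ?z] assms by simp
    ultimately have "norm (Gamma ?z) * (1 + y\<^sup>2) \<le> Gamma \<kappa> + Gamma (\<kappa> + 2)"
      by (simp add: algebra_simps)
    moreover have "1 + y\<^sup>2 > 0"
      by (simp add: add_pos_nonneg)
    ultimately show ?thesis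
      by (simp add: field_simps)
  qed
  from order_trans[OF this abs_ge_self]
  show "AE y in lborel. norm (Gamma (Complex \<kappa> (B * y))) \<le> norm ((Gamma \<kappa> + Gamma (\<kappa> + 2)) * inverse (1 + (B * y)\<^sup>2))"
    unfolding real_norm_def by (intro AE_I2)
qed

text \<open>For small \<open>\<sigma>\<close> the Gaussian concentrates at
  \<open>t0 = exp (u / B)\<close>, where the Gamma density is positive. On the interval
  \<open>?J\<close> of length \<open>t0 * \<sigma> / B\<close> starting at \<open>t0\<close> it has
  height of order \<open>1 / \<sigma>\<close>, so this part of the integral has a lower bound
  independent of \<open>\<sigma>\<close>.\<close>

lemma Gamma_gaussian_lower_bound:
  fixes B \<kappa> u :: real
  assumes "B > 0" "\<kappa> > 0"
  obtains c where "c > 0"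
    "\<And>\<sigma>. 0 < \<sigma> \<Longrightarrow> \<sigma> \<le> 1 \<Longrightarrow>
      c \<le> (LBINT t. gamma_weight \<kappa> t * (sqrt (2 * pi) / \<sigma> * exp (- ((u - B * ln t) / \<sigma>)\<^sup>2 / 2)))"
proof -
  define t0 where "t0 = exp (u / B)"
  have t0: "t0 > 0" "B * ln t0 = u"
    using assms by (simp_all add: t0_def)
  \<comment> \<open>The largest of the intervals \<open>?J\<close>, for \<open>\<sigma> = 1\<close>;
    the minimum of the density on it serves all \<open>\<sigma> \<le> 1\<close>.\<close>
  let ?K = "{t0..t0 * (1 + 1 / B)}"
  have sub: "t0 * 1 \<le> t0 * (1 + 1 / B)"
    using t0 assms by (intro mult_left_mono) auto
  have "continuous_on ?K (\<lambda>t. t powr (\<kappa> - 1) * exp (- t))"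
    using t0 by (intro continuous_intros) auto
  then obtain t1 where t1: "t1 \<in> ?K" "\<And>t. t \<in> ?K \<Longrightarrow> t1 powr (\<kappa> - 1) * exp (- t1) \<le> t powr (\<kappa> - 1) * exp (- t)"
    using continuous_attains_inf[of ?K "\<lambda>t. t powr (\<kappa> - 1) * exp (- t)"] sub by auto
  define m where "m = t1 powr (\<kappa> - 1) * exp (- t1)"
  have m: "m > 0" "\<And>t. t \<in> ?K \<Longrightarrow> m \<le> gamma_weight \<kappa> t"
    using t1 t0 by (auto simp: m_def gamma_weight_def)
  \<comment> \<open>Minimum of the density, times the height
    \<open>sqrt (2 * pi) / \<sigma> * exp (- 1 / 2)\<close> at one standard deviation, times the
    length of \<open>?J\<close>; \<open>\<sigma>\<close> cancels.\<close>
  define c where "c = m * sqrt (2 * pi) * exp (- 1 / 2) * (t0 / B)"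
  show ?thesis
  proof (rule that)
    show "c > 0"
      using m t0 assms by (simp add: c_def)
    fix \<sigma> :: real
    assume \<sigma>: "0 < \<sigma>" "\<sigma> \<le> 1"
    let ?N = "\<lambda>t. sqrt (2 * pi) / \<sigma> * exp (- ((u - B * ln t) / \<sigma>)\<^sup>2 / 2)"
    let ?J = "{t0..t0 * (1 + \<sigma> / B)}"
    have JK: "?J \<subseteq> ?K"
      using \<sigma> t0 assms by (auto intro!: order_trans[OF _ mult_left_mono] simp: divide_right_mono)
    have N: "sqrt (2 * pi) / \<sigma> * exp (- 1 / 2) \<le> ?N t" if "t \<in> ?J" for t
    proof -
      have "t > 0" using that t0 by auto
      \<comment> \<open>\<open>ln x \<le> x - 1\<close> turns the relative width
        \<open>\<sigma> / B\<close> into a distance of at most \<open>\<sigma>\<close> between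
        \<open>B * ln t\<close> and \<open>u\<close>.\<close>
      have "ln (t / t0) \<le> t / t0 - 1"
        using \<open>t > 0\<close> t0 by (intro ln_le_minus_one) auto
      also have "t / t0 \<le> 1 + \<sigma> / B"
        using that t0 by (simp add: field_simps)
      finally have "B * ln (t / t0) \<le> \<sigma>"
        using assms by (simp add: field_simps)
      moreover have "B * ln t = B * ln (t / t0) + u" "ln (t / t0) \<ge> 0"
        using \<open>t > 0\<close> t0 that by (simp_all add: ln_div field_simps)
      ultimately have "\<bar>u - B * ln t\<bar> \<le> \<sigma>"
        using assms by simp
      then have "((u - B * ln t) / \<sigma>)\<^sup>2 \<le> 1"
        using \<sigma> by (simp add: abs_square_le_1)
      then show ?thesis
        using \<sigma> by (intro mult_left_mono) auto
    qed
    have "c = (LBINT t. indicator ?J t * (m * (sqrt (2 * pi) / \<sigma> * exp (- 1 / 2))))"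
      using t0 assms \<sigma> by (simp add: c_def field_simps)
    also have "\<dots> \<le> (LBINT t. gamma_weight \<kappa> t * ?N t)"
    proof (rule integral_mono)
      show "integrable lborel (\<lambda>t. indicator ?J t * (m * (sqrt (2 * pi) / \<sigma> * exp (- 1 / 2))))"
        by (intro integrable_mult_left integrable_real_indicator) (auto simp: emeasure_lborel_Icc_eq)
      show "integrable lborel (\<lambda>t. gamma_weight \<kappa> t * ?N t)"
      proof (rule Bochner_Integration.integrable_bound)
        show "integrable lborel (\<lambda>t. gamma_weight \<kappa> t * (sqrt (2 * pi) / \<sigma>))"
          using assms(2) by (simp add: integrable_gamma_weight)
        have "\<bar>?N t\<bar> \<le> sqrt (2 * pi) / \<sigma> * 1" for t
          unfolding abs_mult using \<sigma> by (intro mult_mono) auto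
        then show "AE t in lborel. norm (gamma_weight \<kappa> t * ?N t) \<le> norm (gamma_weight \<kappa> t * (sqrt (2 * pi) / \<sigma>))"
          unfolding norm_mult using \<sigma> by (intro AE_I2 mult_left_mono) auto
      qed measurable
      show "indicator ?J t * (m * (sqrt (2 * pi) / \<sigma> * exp (- 1 / 2))) \<le> gamma_weight \<kappa> t * ?N t" for t
      proof (cases "t \<in> ?J")
        case True
        then show ?thesis
          using mult_mono[OF m(2) N] JK \<sigma> m(1) gamma_weight_nonneg[of \<kappa> t] by auto
      next
        case False
        then show ?thesis
          using \<sigma> gamma_weight_nonneg[of \<kappa> t] by (simp del: atLeastAtMost_iff)
      qed
    qed
    finally show "c \<le> (LBINT t. gamma_weight \<kappa> t * ?N t)" .
  qed
qed

text \<open>The integrals regularised by a Gaussian factor are convolutions of a positive density with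
  positive Gaussian densities, and they stay away from 0 when the factor tends to 1.\<close>

lemma fourier_pos_Gamma:
  assumes "\<kappa> > 0" "B > 0"
  shows "fourier_pos (\<lambda>y. Gamma (Complex \<kappa> (B * y)))"
proof -
  let ?f = "\<lambda>y. Gamma (Complex \<kappa> (B * y))"
  have fint: "integrable lborel ?f"
    using assms by (intro Gamma_vertical_integrable) auto
  then have [measurable]: "?f \<in> borel_measurable borel"
    by auto
  have "(CLBINT y. ?f y * cis (- (y * u))) \<in> \<real> \<and> Re (CLBINT y. ?f y * cis (- (y * u))) > 0" for u
  proof -
    let ?G = "\<lambda>\<sigma> y. complex_of_real (exp (- (\<sigma> * y)\<^sup>2 / 2))"
    let ?N = "\<lambda>\<sigma> t. sqrt (2 * pi) / \<sigma> * exp (- ((u - B * ln t) / \<sigma>)\<^sup>2 / 2)"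
    \<comment> \<open>The Gaussian factor makes the double integral absolutely convergent. Euler's
      integral contributes the frequency \<open>B * ln t\<close>, so the inner integral over
      \<open>y\<close> is the Gaussian transform at \<open>u - B * ln t\<close>.\<close>
    have reg: "(CLBINT y. ?f y * cis (- (y * u)) * ?G \<sigma> y) = of_real (LBINT t. gamma_weight \<kappa> t * ?N \<sigma> t)"
      if "\<sigma> > 0" for \<sigma>
    proof -
      let ?F = "\<lambda>y t. complex_of_real (gamma_weight \<kappa> t) * (?G \<sigma> y * cis (- (y * (u - B * ln t))))"
      note gauss = has_bochner_integral_gaussian[OF that, unfolded has_bochner_integral_iff]
      have cis_eq: "cis (- (y * (u - B * ln t))) = cis (B * y * ln t) * cis (- (y * u))" for t y
        by (simp add: cis_mult algebra_simps)
      have Gint: "integrable lborel (\<lambda>y. norm (?G \<sigma> y))"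
        using integrable_norm[OF gauss[of 0, THEN conjunct1]] by (simp add: norm_mult)
      have Fint: "integrable (lborel \<Otimes>\<^sub>M lborel) (case_prod ?F)"
      proof (rule lborel_pair.Fubini_integrable)
        have "(LBINT t. norm (case_prod ?F (y, t))) = Gamma \<kappa> * norm (?G \<sigma> y)" for y
          using assms by (simp add: norm_mult gamma_weight_nonneg integral_gamma_weight)
        then show "integrable lborel (\<lambda>y. LBINT t. norm (case_prod ?F (y, t)))"
          using Gint by simp
        have "integrable lborel (\<lambda>t. ?F y t)" for y
        proof (rule Bochner_Integration.integrable_bound)
          show "integrable lborel (\<lambda>t. gamma_weight \<kappa> t * norm (?G \<sigma> y))"
            using assms by (intro integrable_mult_left integrable_gamma_weight)
          show "AE t in lborel. norm (?F y t) \<le> norm (gamma_weight \<kappa> t * norm (?G \<sigma> y))"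
            by (simp add: norm_mult)
        qed measurable
        then show "AE y in lborel. integrable lborel (\<lambda>t. case_prod ?F (y, t))"
          by simp
      qed measurable
      have "(CLBINT y. ?f y * cis (- (y * u)) * ?G \<sigma> y) = (CLBINT y. CLBINT t. ?F y t)"
      proof (intro Bochner_Integration.integral_cong refl)
        fix y
        have "(CLBINT t. ?F y t) = (CLBINT t. (?G \<sigma> y * cis (- (y * u))) *
                (complex_of_real (gamma_weight \<kappa> t) * cis (B * y * ln t)))"
          unfolding cis_eq by (simp add: mult_ac)
        also have "\<dots> = (?G \<sigma> y * cis (- (y * u))) * ?f y"
          using has_bochner_integral_Gamma[OF assms(1), of "B * y"]
          by (simp add: has_bochner_integral_iff)
        finally show "?f y * cis (- (y * u)) * ?G \<sigma> y = (CLBINT t. ?F y t)"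
          by (simp add: mult_ac)
      qed
      also have "\<dots> = (CLBINT t. CLBINT y. ?F y t)"
        using lborel_pair.Fubini_integral[OF Fint] by simp
      also have "\<dots> = (CLBINT t. of_real (gamma_weight \<kappa> t * ?N \<sigma> t))"
        using gauss by simp
      also have "\<dots> = of_real (LBINT t. gamma_weight \<kappa> t * ?N \<sigma> t)"
        by (rule integral_complex_of_real)
      finally show ?thesis .
    qed
    obtain c where c: "c > 0"
      "\<And>\<sigma>. 0 < \<sigma> \<Longrightarrow> \<sigma> \<le> 1 \<Longrightarrow>
        c \<le> (LBINT t. gamma_weight \<kappa> t * ?N \<sigma> t)"
      using Gamma_gaussian_lower_bound[OF assms(2,1)] by blast
    define S where "S n = 1 / real (Suc n)" for n
    have S: "S n > 0" "S n \<le> 1" for n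
      by (simp_all add: S_def)
    have "S \<longlonglongrightarrow> 0"
      unfolding S_def by (rule LIMSEQ_Suc[OF lim_1_over_n])
    have lim: "(\<lambda>n. CLBINT y. ?f y * cis (- (y * u)) * ?G (S n) y) \<longlonglongrightarrow> (CLBINT y. ?f y * cis (- (y * u)))"
    proof (rule integral_dominated_convergence)
      show "integrable lborel (\<lambda>y. norm (?f y))"
        using fint by simp
      have "(\<lambda>n. ?f y * cis (- (y * u)) * ?G (S n) y) \<longlonglongrightarrow> ?f y * cis (- (y * u)) * of_real (exp (- (0 * y)\<^sup>2 / 2))" for y
        by (intro tendsto_intros \<open>S \<longlonglongrightarrow> 0\<close>) auto
      then show "AE y in lborel. (\<lambda>n. ?f y * cis (- (y * u)) * ?G (S n) y) \<longlonglongrightarrow> ?f y * cis (- (y * u))"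
        by simp
      have "norm (?f y * cis (- (y * u)) * ?G (S n) y) \<le> norm (?f y) * 1" for y n
        unfolding norm_mult mult.assoc by (intro mult_left_mono) auto
      then show "AE y in lborel. norm (?f y * cis (- (y * u)) * ?G (S n) y) \<le> norm (?f y)" for n
        by simp
    qed measurable
    \<comment> \<open>A strict inequality could be lost in the limit; membership in this closed set
      keeps both realness and the uniform bound \<open>c\<close>.\<close>
    have cl: "closed {z. z \<in> \<real> \<and> c \<le> Re z}"
      unfolding Collect_conj_eq by (intro closed_Int closed_Collect_le continuous_intros) (simp add: closed_complex_Reals)
    have mem: "(CLBINT y. ?f y * cis (- (y * u)) * ?G (S n) y) \<in> {z. z \<in> \<real> \<and> c \<le> Re z}" for n
      unfolding reg[OF S(1)] using c(2)[OF S] by simp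
    have "(CLBINT y. ?f y * cis (- (y * u))) \<in> {z. z \<in> \<real> \<and> c \<le> Re z}"
      by (rule closed_sequentially[OF cl mem lim])
    then show ?thesis
      using c(1) by auto
  qed
  then show ?thesis
    using fint by (simp add: fourier_pos_def)
qed

section \<open>Moving the contour to a vertical line\<close>

text \<open>The two ends move independently, as in the definition of the H-function, so convergence
  along this filter is more than the existence of a principal value.\<close>

abbreviation contour_ends :: "(real \<times> real) filter" where
  "contour_ends \<equiv> at_bot \<times>\<^sub>F at_top"

lemma filterlim_fst_contour_ends: "filterlim fst at_bot contour_ends"
  and filterlim_snd_contour_ends: "filterlim snd at_top contour_ends"
  by (rule filterlim_fst filterlim_snd)+

lemma contour_ends_neq_bot: "contour_ends \<noteq> bot"
  by (simp add: prod_filter_eq_bot trivial_limit_at_bot_linorder trivial_limit_at_top_linorder)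

lemma eventually_contour_ends_less: "eventually (\<lambda>p. fst p < snd p) contour_ends"
proof -
  have "eventually (\<lambda>p. fst p < 0) contour_ends" "eventually (\<lambda>p. snd p > 0) contour_ends"
    using filterlim_fst_contour_ends filterlim_snd_contour_ends
    by (auto simp: filterlim_at_bot_dense filterlim_at_top_dense)
  then show ?thesis
    by eventually_elim simp
qed

text \<open>Limits known for the vertical line, which is parametrised by height, are transferred in
  this way to its segments cut off at the heights of the end points of \<open>C\<close>.\<close>

lemma contour_Im_ends:
  assumes "contour_from_to_ii_infinity \<gamma> C"
  shows "filterlim (\<lambda>p. (Im (C (fst p)), Im (C (snd p)))) contour_ends contour_ends"
    and "filterlim (\<lambda>p. Im (C (fst p))) at_bot contour_ends"
    and "filterlim (\<lambda>p. Im (C (snd p))) at_top contour_ends"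
proof -
  show 1: "filterlim (\<lambda>p. Im (C (fst p))) at_bot contour_ends"
    and 2: "filterlim (\<lambda>p. Im (C (snd p))) at_top contour_ends"
    using assms unfolding contour_from_to_ii_infinity_def
    by (auto intro: filterlim_compose filterlim_fst_contour_ends filterlim_snd_contour_ends)
  then show "filterlim (\<lambda>p. (Im (C (fst p)), Im (C (snd p)))) contour_ends contour_ends"
    by (rule filterlim_Pair)
qed

lemma valid_path_contour_part:
  assumes "contour_from_to_ii_infinity \<gamma> C" "S < T"
  shows "valid_path (C \<circ> linepath S T)" "path_image (C \<circ> linepath S T) = C ` {S..T}"
proof -
  have "linepath S T = (\<lambda>x. (T - S) *\<^sub>R x + S)"
    by (auto simp: linepath_def algebra_simps)
  moreover have "(\<lambda>x. (T - S) * x + S) ` {0..1} = {S..T}"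
    using assms(2) by (simp add: image_affinity_atLeastAtMost)
  ultimately show "valid_path (C \<circ> linepath S T)"
    using assms piecewise_C1_differentiable_affine[of C "T - S" S "{0..1}"]
    unfolding valid_path_def contour_from_to_ii_infinity_def by simp
  show "path_image (C \<circ> linepath S T) = C ` {S..T}"
    using assms(2) by (simp add: path_image_compose closed_segment_eq_real_ivl)
qed

text \<open>Near the ends the real part is close to \<open>\<gamma>\<close>, and the piece in
  between is compact. The bound confines all the loops below to a single strip.\<close>

lemma contour_Re_bounded:
  assumes "contour_from_to_ii_infinity \<gamma> C"
  obtains R where "\<And>t. \<bar>Re (C t)\<bar> \<le> R"
proof -
  have lim: "((\<lambda>t. Re (C t)) \<longlongrightarrow> \<gamma>) at_bot" "((\<lambda>t. Re (C t)) \<longlongrightarrow> \<gamma>) at_top"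
    and pw: "\<And>S T. C piecewise_C1_differentiable_on {S..T}"
    using assms by (auto simp: contour_from_to_ii_infinity_def)
  have "eventually (\<lambda>t. dist (Re (C t)) \<gamma> < 1) at_bot" "eventually (\<lambda>t. dist (Re (C t)) \<gamma> < 1) at_top"
    using lim by (auto simp: tendsto_iff)
  then obtain S T where ST: "\<And>t. t \<le> S \<Longrightarrow> dist (Re (C t)) \<gamma> < 1" "\<And>t. t \<ge> T \<Longrightarrow> dist (Re (C t)) \<gamma> < 1"
    unfolding eventually_at_bot_linorder eventually_at_top_linorder by metis
  have "compact ((\<lambda>t. Re (C t)) ` {S..T})"
    using pw[of S T] by (intro compact_continuous_image continuous_intros)
      (auto simp: piecewise_C1_differentiable_on_def)
  then have "bounded ((\<lambda>t. Re (C t)) ` {S..T})"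
    by (rule compact_imp_bounded)
  then obtain B where "\<forall>x\<in>(\<lambda>t. Re (C t)) ` {S..T}. norm x \<le> B"
    unfolding bounded_iff ..
  then have B: "\<bar>Re (C t)\<bar> \<le> B" if "t \<in> {S..T}" for t
    using that by simp
  show ?thesis
  proof (rule that)
    fix t
    show "\<bar>Re (C t)\<bar> \<le> max B (\<bar>\<gamma>\<bar> + 1)"
      using ST[of t] B[of t] by (cases "t \<le> S"; cases "t \<ge> T") (auto simp: dist_real_def)
  qed
qed

section \<open>Closing the contour up with a vertical line\<close>

text \<open>The two end parameters form one pair, so that the loops are indexed by
  \<open>contour_ends\<close>. The vertical piece runs downwards: apart from the horizontal pieces,
  the loop integral is the integral along \<open>C\<close> minus the one along the line.\<close>

definition closed_up :: "(real \<Rightarrow> complex) \<Rightarrow> real \<Rightarrow> real \<times> real \<Rightarrow> real \<Rightarrow> complex" where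
  "closed_up C g p =
     (C \<circ> linepath (fst p) (snd p)) +++
     linepath (C (snd p)) (Complex g (Im (C (snd p)))) +++
     linepath (Complex g (Im (C (snd p)))) (Complex g (Im (C (fst p)))) +++
     linepath (Complex g (Im (C (fst p)))) (C (fst p))"

lemma closed_up_loop: "pathfinish (closed_up C g p) = pathstart (closed_up C g p)"
  by (simp add: closed_up_def pathfinish_compose pathstart_compose)

lemma valid_path_closed_up:
  assumes "contour_from_to_ii_infinity \<gamma> C" "fst p < snd p"
  shows "valid_path (closed_up C g p)"
  using valid_path_contour_part[OF assms] unfolding closed_up_def
  by (intro valid_path_join) (auto simp: pathfinish_compose linepath_1')

lemma path_image_closed_up:
  assumes "contour_from_to_ii_infinity \<gamma> C" "fst p < snd p"
  shows "path_image (closed_up C g p) =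
    C ` {fst p..snd p} \<union> closed_segment (C (snd p)) (Complex g (Im (C (snd p)))) \<union>
    closed_segment (Complex g (Im (C (snd p)))) (Complex g (Im (C (fst p)))) \<union>
    closed_segment (Complex g (Im (C (fst p)))) (C (fst p))"
  using valid_path_contour_part[OF assms] unfolding closed_up_def
  by (simp add: path_image_join pathfinish_compose linepath_1' Un_assoc)

lemma closed_segment_horizontal:
  assumes "s \<in> closed_segment z w" "Im z = Im w" "\<bar>Re z\<bar> \<le> R" "\<bar>Re w\<bar> \<le> R"
  shows "Im s = Im w" "\<bar>Re s\<bar> \<le> R"
proof -
  obtain u where u: "0 \<le> u" "u \<le> 1" "s = (1 - u) *\<^sub>R z + u *\<^sub>R w"
    using assms(1) by (auto simp: closed_segment_def)
  show "Im s = Im w"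
    unfolding u using assms(2) by (simp add: algebra_simps)
  have "Re s = (1 - u) * Re z + u * Re w"
    unfolding u by simp
  then have "\<bar>Re s\<bar> \<le> (1 - u) * \<bar>Re z\<bar> + u * \<bar>Re w\<bar>"
    using abs_triangle_ineq[of "(1 - u) * Re z" "u * Re w"] u(1,2) by (simp add: abs_mult)
  also have "\<dots> \<le> (1 - u) * R + u * R"
    using u assms by (intro add_mono mult_left_mono) auto
  finally show "\<bar>Re s\<bar> \<le> R" by (simp add: algebra_simps)
qed

lemma closed_segment_vertical:
  assumes "s \<in> closed_segment (Complex g x) (Complex g y)"
  shows "Re s = g"
proof -
  obtain u where "s = (1 - u) *\<^sub>R Complex g x + u *\<^sub>R Complex g y"
    using assms by (auto simp: closed_segment_def)
  then have "Re s = (1 - u) * g + u * g" by simp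
  then show ?thesis by (simp add: algebra_simps)
qed

text \<open>The set \<open>P\<close> is real: eventually the horizontal segments lie off the real
  axis, the vertical one meets it only at \<open>g\<close>, and \<open>C\<close> avoids
  \<open>P\<close> by assumption.\<close>

lemma closed_up_avoids:
  assumes C: "contour_from_to_ii_infinity \<gamma> C"
    and P: "P \<subseteq> \<real>" "range C \<inter> P = {}" "complex_of_real g \<notin> P"
  shows "eventually (\<lambda>p. path_image (closed_up C g p) \<subseteq> - P) contour_ends"
proof -
  obtain R0 where R0: "\<And>t. \<bar>Re (C t)\<bar> \<le> R0"
    using contour_Re_bounded[OF C] by blast
  define R where "R = max R0 \<bar>g\<bar>"
  have R: "\<bar>Re (C t)\<bar> \<le> R" "\<bar>g\<bar> \<le> R" for t
    using R0[of t] by (auto simp: R_def)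
  have "eventually (\<lambda>p. Im (C (fst p)) < 0) contour_ends" "eventually (\<lambda>p. Im (C (snd p)) > 0) contour_ends"
    using contour_Im_ends(2,3)[OF C] by (auto simp: filterlim_at_bot_dense filterlim_at_top_dense)
  then show ?thesis
    using eventually_contour_ends_less
  proof eventually_elim
    case (elim p)
    show ?case
    proof
      fix s assume s: "s \<in> path_image (closed_up C g p)"
      show "s \<in> - P"
      proof
        assume "s \<in> P"
        then have "Im s = 0" "s \<notin> range C" "s \<noteq> of_real g"
          using P by (auto simp: complex_is_Real_iff)
        then have "Re s \<noteq> g"
          by (auto simp: complex_eq_iff)
        have "s \<in> closed_segment (C (snd p)) (Complex g (Im (C (snd p)))) \<or>
              s \<in> closed_segment (Complex g (Im (C (snd p)))) (Complex g (Im (C (fst p)))) \<or>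
              s \<in> closed_segment (Complex g (Im (C (fst p)))) (C (fst p))"
          using s \<open>s \<notin> range C\<close> path_image_closed_up[OF C elim(3)] by auto
        then show False
          using closed_segment_horizontal(1)[of s _ _ R] closed_segment_vertical R \<open>Im s = 0\<close> \<open>Re s \<noteq> g\<close> elim
          by fastforce
      qed
    qed
  qed
qed

text \<open>Only the horizontal segments remain; their length is at most \<open>2 * R\<close>, and
  \<open>f\<close> is at most \<open>K\<close> divided by the height on them. The function
  \<open>f\<close> is general because the lemma serves both the integrand of the H-function and the
  kernel \<open>1 / (s - w)\<close> of the winding number.\<close>

lemma closed_up_integral:
  assumes C: "contour_from_to_ii_infinity \<gamma> C"
    and f: "f holomorphic_on - P" "closed P" "P \<subseteq> \<real>"
    and P: "range C \<inter> P = {}" "complex_of_real g \<notin> P"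
    and decay: "\<And>R. \<exists>K. \<forall>s. \<bar>Re s\<bar> \<le> R \<longrightarrow> 1 \<le> \<bar>Im s\<bar> \<longrightarrow> norm (f s) \<le> K / \<bar>Im s\<bar>"
  shows "((\<lambda>p. contour_integral (closed_up C g p) f - 
      (contour_integral (C \<circ> linepath (fst p) (snd p)) f -
       contour_integral (linepath (Complex g (Im (C (fst p)))) (Complex g (Im (C (snd p))))) f)) \<longlongrightarrow> 0) contour_ends"
proof -
  obtain R0 where R0: "\<And>t. \<bar>Re (C t)\<bar> \<le> R0"
    using contour_Re_bounded[OF C] by blast
  define R where "R = max R0 \<bar>g\<bar>"
  have R: "\<bar>Re (C t)\<bar> \<le> R" "\<bar>g\<bar> \<le> R" for t
    using R0[of t] by (auto simp: R_def)
  obtain K0 where K0: "\<And>s. \<bar>Re s\<bar> \<le> R \<Longrightarrow> 1 \<le> \<bar>Im s\<bar> \<Longrightarrow> norm (f s) \<le> K0 / \<bar>Im s\<bar>"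
    using decay by blast
  define K where "K = max K0 0"
  have K: "norm (f s) \<le> K / \<bar>Im s\<bar>" if "\<bar>Re s\<bar> \<le> R" "1 \<le> \<bar>Im s\<bar>" for s
    using order_trans[OF K0[OF that] divide_right_mono[of K0 K "\<bar>Im s\<bar>"]] by (simp add: K_def)
  have "K \<ge> 0" by (simp add: K_def)
  let ?E = "\<lambda>p. K / \<bar>Im (C (fst p))\<bar> * (2 * R) + K / \<bar>Im (C (snd p))\<bar> * (2 * R)"
  have hor: "norm (contour_integral (linepath z w) f) \<le> K / \<bar>Im w\<bar> * (2 * R)"
    if "f contour_integrable_on linepath z w" "Im z = Im w" "\<bar>Re z\<bar> \<le> R" "\<bar>Re w\<bar> \<le> R" "1 \<le> \<bar>Im w\<bar>" for z w
  proof -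
    have "norm (contour_integral (linepath z w) f) \<le> K / \<bar>Im w\<bar> * norm (w - z)"
    proof (rule contour_integral_bound_linepath)
      show "norm (f s) \<le> K / \<bar>Im w\<bar>" if "s \<in> closed_segment z w" for s
        using K[of s] closed_segment_horizontal[OF that \<open>Im z = Im w\<close>] \<open>\<bar>Re z\<bar> \<le> R\<close> \<open>\<bar>Re w\<bar> \<le> R\<close> \<open>1 \<le> \<bar>Im w\<bar>\<close> by auto
    qed (use that \<open>K \<ge> 0\<close> in auto)
    also have "\<dots> \<le> K / \<bar>Im w\<bar> * (2 * R)"
      using cmod_le[of "w - z"] that \<open>K \<ge> 0\<close> by (intro mult_left_mono) auto
    finally show ?thesis .
  qed
  have "eventually (\<lambda>p. Im (C (fst p)) < -1) contour_ends" "eventually (\<lambda>p. Im (C (snd p)) > 1) contour_ends"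
    using contour_Im_ends(2,3)[OF C] by (auto simp: filterlim_at_bot_dense filterlim_at_top_dense)
  then have "eventually (\<lambda>p. norm (contour_integral (closed_up C g p) f - 
      (contour_integral (C \<circ> linepath (fst p) (snd p)) f -
       contour_integral (linepath (Complex g (Im (C (fst p)))) (Complex g (Im (C (snd p))))) f)) \<le> ?E p) contour_ends"
    using eventually_contour_ends_less closed_up_avoids[OF C f(3) P]
  proof eventually_elim
    case (elim p)
    note vp = valid_path_contour_part[OF C elim(3)]
    note pi = path_image_closed_up[OF C elim(3), of g]
    let ?h1 = "linepath (C (snd p)) (Complex g (Im (C (snd p))))"
    let ?v = "linepath (Complex g (Im (C (snd p)))) (Complex g (Im (C (fst p))))"
    let ?h2 = "linepath (Complex g (Im (C (fst p)))) (C (fst p))"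
    have ci: "f contour_integrable_on q" if "valid_path q" "path_image q \<subseteq> path_image (closed_up C g p)" for q
      using contour_integrable_holomorphic_simple[OF f(1) _ that(1)] that(2) elim(4) f(2) by (auto simp: open_Compl)
    have ints: "f contour_integrable_on (C \<circ> linepath (fst p) (snd p))" "f contour_integrable_on ?h1"
       "f contour_integrable_on ?v" "f contour_integrable_on ?h2"
      using vp pi by (auto intro!: ci)
    have "contour_integral (closed_up C g p) f = contour_integral (C \<circ> linepath (fst p) (snd p)) f +
        (contour_integral ?h1 f + (contour_integral ?v f + contour_integral ?h2 f))"
      unfolding closed_up_def using vp(1) ints
      by (simp add: contour_integral_join contour_integrable_joinI valid_path_join pathfinish_compose linepath_1')
    moreover have "continuous_on (path_image ?v) f"
      using pi elim(4) by (intro continuous_on_subset[OF holomorphic_on_imp_continuous_on[OF f(1)]]) auto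
    then have "contour_integral ?v f = - contour_integral (linepath (Complex g (Im (C (fst p)))) (Complex g (Im (C (snd p))))) f"
      by (intro contour_integral_reverse_linepath) simp
    moreover have "norm (contour_integral ?h1 f) \<le> K / \<bar>Im (C (snd p))\<bar> * (2 * R)"
      using hor[OF ints(2)] R elim by simp
    moreover have "norm (contour_integral ?h2 f) \<le> K / \<bar>Im (C (fst p))\<bar> * (2 * R)"
      using hor[OF ints(4)] R elim by simp
    ultimately show ?case
      using norm_triangle_ineq[of "contour_integral ?h1 f" "contour_integral ?h2 f"] by (simp add: algebra_simps)
  qed
  moreover have "(?E \<longlongrightarrow> 0) contour_ends"
  proof -
    have "filterlim (\<lambda>p. - Im (C (fst p))) at_top contour_ends"
      using contour_Im_ends(2)[OF C] by (simp only: filterlim_uminus_at_bot)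
    then have "filterlim (\<lambda>p. \<bar>Im (C (fst p))\<bar>) at_top contour_ends"
      by (rule filterlim_at_top_mono) (auto intro: always_eventually)
    moreover have "filterlim (\<lambda>p. \<bar>Im (C (snd p))\<bar>) at_top contour_ends"
      using contour_Im_ends(3)[OF C] by (rule filterlim_at_top_mono) (auto intro: always_eventually)
    ultimately have "((\<lambda>p. K / \<bar>Im (C (fst p))\<bar>) \<longlongrightarrow> 0) contour_ends" "((\<lambda>p. K / \<bar>Im (C (snd p))\<bar>) \<longlongrightarrow> 0) contour_ends"
      by (auto intro: tendsto_divide_0 filterlim_at_top_imp_at_infinity)
    then show ?thesis
      by (intro tendsto_add_zero tendsto_mult_left_zero)
  qed
  ultimately show ?thesis
    by (rule Lim_null_comparison)
qed

text \<open>The winding number of a loop is an integer, so it vanishes once its real part is small.\<close>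

lemma winding_number_closed_up_eventually_0:
  assumes C: "contour_from_to_ii_infinity \<gamma> C"
    and w: "w \<notin> range C" "w \<in> \<real>" "w \<noteq> of_real g"
    and l: "((\<lambda>p. Re (winding_number (C \<circ> linepath (fst p) (snd p)) w)) \<longlongrightarrow> l) contour_ends"
      "((\<lambda>p. Re (winding_number (linepath (Complex g (fst p)) (Complex g (snd p))) w)) \<longlongrightarrow> l) contour_ends"
  shows "eventually (\<lambda>p. winding_number (closed_up C g p) w = 0) contour_ends"
proof -
  let ?f = "\<lambda>s. 1 / (s - w)"
  let ?v = "\<lambda>p. linepath (Complex g (Im (C (fst p)))) (Complex g (Im (C (snd p))))"
  let ?d = "\<lambda>p. contour_integral (closed_up C g p) ?f -
    (contour_integral (C \<circ> linepath (fst p) (snd p)) ?f - contour_integral (?v p) ?f)"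
  have "(?d \<longlongrightarrow> 0) contour_ends"
  proof (rule closed_up_integral[OF C])
    show "?f holomorphic_on - {w}"
      by (intro holomorphic_intros) auto
    \<comment> \<open>The pole \<open>w\<close> is real, so \<open>|s - w| \<ge> |Im s|\<close>, and
      the constant 1 works in every strip.\<close>
    show "\<exists>K. \<forall>s. \<bar>Re s\<bar> \<le> R \<longrightarrow> 1 \<le> \<bar>Im s\<bar> \<longrightarrow> norm (?f s) \<le> K / \<bar>Im s\<bar>" for R
    proof (intro exI[of _ 1] allI impI)
      fix s :: complex
      assume "1 \<le> \<bar>Im s\<bar>"
      moreover have "\<bar>Im s\<bar> \<le> norm (s - w)"
        using abs_Im_le_cmod[of "s - w"] w(2) by (simp add: complex_is_Real_iff)
      ultimately show "norm (?f s) \<le> 1 / \<bar>Im s\<bar>"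
        by (simp add: norm_divide frac_le)
    qed
  qed (use w in auto)
  then have "((\<lambda>p. Re (1 / (2 * pi * \<i>) * ?d p)) \<longlongrightarrow> Re (1 / (2 * pi * \<i>) * 0)) contour_ends"
    by (intro tendsto_intros)
  moreover have "((\<lambda>p. Re (winding_number (?v p) w)) \<longlongrightarrow> l) contour_ends"
    using filterlim_compose[OF l(2) contour_Im_ends(1)[OF C]] by simp
  \<comment> \<open>The common limit \<open>l\<close> cancels: it matters only that \<open>w\<close>
    is on the same side of both contours, not on which.\<close>
  ultimately have "((\<lambda>p. Re (1 / (2 * pi * \<i>) * ?d p) +
      (Re (winding_number (C \<circ> linepath (fst p) (snd p)) w) - Re (winding_number (?v p) w))) \<longlongrightarrow> 0 + (l - l)) contour_ends"
    using l(1) by (intro tendsto_intros) auto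
  then have "eventually (\<lambda>p. \<bar>Re (1 / (2 * pi * \<i>) * ?d p) +
      (Re (winding_number (C \<circ> linepath (fst p) (snd p)) w) - Re (winding_number (?v p) w))\<bar> < 1) contour_ends"
    by (auto simp: tendsto_iff dist_real_def)
  moreover have "eventually (\<lambda>p. path_image (closed_up C g p) \<subseteq> - {w}) contour_ends"
    using w by (intro closed_up_avoids[OF C]) auto
  ultimately show ?thesis
    using eventually_contour_ends_less
  proof eventually_elim
    case (elim p)
    note vp = valid_path_contour_part[OF C elim(3)]
    have "winding_number (closed_up C g p) w = 1 / (2 * pi * \<i>) * contour_integral (closed_up C g p) ?f"
      using elim valid_path_closed_up[OF C elim(3)] by (intro winding_number_valid_path) auto
    moreover have "winding_number (C \<circ> linepath (fst p) (snd p)) w = 1 / (2 * pi * \<i>) * contour_integral (C \<circ> linepath (fst p) (snd p)) ?f"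
      using vp w by (intro winding_number_valid_path) auto
    moreover have "winding_number (?v p) w = 1 / (2 * pi * \<i>) * contour_integral (?v p) ?f"
    proof (rule winding_number_valid_path)
      have "w \<notin> closed_segment (Complex g (Im (C (fst p)))) (Complex g (Im (C (snd p))))"
        using w(2,3) closed_segment_vertical[of w g] by (auto simp: complex_is_Real_iff complex_eq_iff)
      then show "w \<notin> path_image (?v p)" by simp
    qed auto
    ultimately have eq: "winding_number (closed_up C g p) w = 1 / (2 * pi * \<i>) * ?d p +
        (winding_number (C \<circ> linepath (fst p) (snd p)) w - winding_number (?v p) w)"
      by (simp add: algebra_simps)
    have "\<bar>Re (winding_number (closed_up C g p) w)\<bar> < 1"
      unfolding eq using elim(1) by simp
    moreover have "winding_number (closed_up C g p) w \<in> \<int>"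
      using elim valid_path_closed_up[OF C elim(3)]
      by (subst integer_winding_number_eq) (auto simp: closed_up_loop valid_path_imp_path)
    ultimately show ?case
      by (auto elim!: Ints_cases simp flip: of_int_abs)
  qed
qed

text \<open>Points of \<open>P\<close> outside the strip have winding number 0 for every loop, by
  convexity of the strip. For a point inside, the winding number is 0 only eventually; finiteness
  makes this hold for all of them simultaneously, and then the loop integral is 0 by the global
  Cauchy theorem.\<close>

lemma contour_integral_shift:
  assumes C: "contour_from_to_ii_infinity \<gamma> C"
    and f: "f holomorphic_on - P" "closed P" "P \<subseteq> \<real>"
    and P: "range C \<inter> P = {}" "complex_of_real g \<notin> P" "\<And>R. finite {w \<in> P. \<bar>Re w\<bar> \<le> R}"
    and decay: "\<And>R. \<exists>K. \<forall>s. \<bar>Re s\<bar> \<le> R \<longrightarrow> 1 \<le> \<bar>Im s\<bar> \<longrightarrow> norm (f s) \<le> K / \<bar>Im s\<bar>"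
    and side: "\<And>w. w \<in> P \<Longrightarrow> \<exists>l.
      ((\<lambda>p. Re (winding_number (C \<circ> linepath (fst p) (snd p)) w)) \<longlongrightarrow> l) contour_ends \<and>
      ((\<lambda>p. Re (winding_number (linepath (Complex g (fst p)) (Complex g (snd p))) w)) \<longlongrightarrow> l) contour_ends"
    and L: "((\<lambda>p. contour_integral (linepath (Complex g (fst p)) (Complex g (snd p))) f) \<longlongrightarrow> L) contour_ends"
  shows "((\<lambda>p. contour_integral (C \<circ> linepath (fst p) (snd p)) f) \<longlongrightarrow> L) contour_ends"
proof -
  let ?v = "\<lambda>p. linepath (Complex g (Im (C (fst p)))) (Complex g (Im (C (snd p))))"
  obtain R0 where R0: "\<And>t. \<bar>Re (C t)\<bar> \<le> R0"
    using contour_Re_bounded[OF C] by blast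
  define R where "R = max R0 \<bar>g\<bar>"
  have R: "\<bar>Re (C t)\<bar> \<le> R" "\<bar>g\<bar> \<le> R" for t
    using R0[of t] by (auto simp: R_def)
  have "eventually (\<lambda>p. \<forall>w\<in>{w \<in> P. \<bar>Re w\<bar> \<le> R}. winding_number (closed_up C g p) w = 0) contour_ends"
  proof (intro eventually_ball_finite P(3) ballI)
    fix w assume "w \<in> {w \<in> P. \<bar>Re w\<bar> \<le> R}"
    then have w: "w \<in> P" "w \<notin> range C" "w \<in> \<real>" "w \<noteq> of_real g"
      using P(1,2) f(3) by auto
    show "eventually (\<lambda>p. winding_number (closed_up C g p) w = 0) contour_ends"
      using side[OF w(1)] winding_number_closed_up_eventually_0[OF C w(2-4)] by blast
  qed
  then have zero: "eventually (\<lambda>p. contour_integral (closed_up C g p) f = 0) contour_ends"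
    using closed_up_avoids[OF C f(3) P(1,2)] eventually_contour_ends_less
  proof eventually_elim
    case (elim p)
    note vp = valid_path_closed_up[OF C elim(3), of g]
    have "path_image (closed_up C g p) \<subseteq> {s. \<bar>Re s\<bar> \<le> R}"
      using path_image_closed_up[OF C elim(3), of g] R closed_segment_horizontal(2) closed_segment_vertical
      by (fastforce)
    moreover have "convex {s. \<bar>Re s\<bar> \<le> R}"
    proof -
      have "{s. \<bar>Re s\<bar> \<le> R} = {s. Re s \<le> R} \<inter> {s. Re s \<ge> - R}"
        by auto
      then show ?thesis
        by (simp add: convex_Int convex_halfspace_Re_le convex_halfspace_Re_ge)
    qed
    ultimately have outside: "winding_number (closed_up C g p) w = 0" if "\<not> \<bar>Re w\<bar> \<le> R" for w
      using that vp by (intro winding_number_zero_outside[of _ "{s. \<bar>Re s\<bar> \<le> R}"])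
        (auto simp: closed_up_loop valid_path_imp_path)
    have "(f has_contour_integral 0) (closed_up C g p)"
    proof (rule Cauchy_theorem_global[OF _ f(1)])
      show "winding_number (closed_up C g p) w = 0" if "w \<notin> - P" for w
        using outside[of w] elim(1) that by (cases "\<bar>Re w\<bar> \<le> R") auto
    qed (use f(2) vp elim(2) in \<open>auto simp: closed_up_loop\<close>)
    then show ?case
      by (rule contour_integral_unique)
  qed
  have "((\<lambda>p. contour_integral (?v p) f) \<longlongrightarrow> L) contour_ends"
    using filterlim_compose[OF L contour_Im_ends(1)[OF C]] by simp
  from tendsto_diff[OF this closed_up_integral[OF C f P(1,2) decay]]
  have lim: "((\<lambda>p. contour_integral (C \<circ> linepath (fst p) (snd p)) f - contour_integral (closed_up C g p) f) \<longlongrightarrow> L) contour_ends"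
    by (simp add: algebra_simps)
  show ?thesis
  proof (rule Lim_transform_eventually[OF lim])
    show "eventually (\<lambda>p. contour_integral (C \<circ> linepath (fst p) (snd p)) f - contour_integral (closed_up C g p) f =
        contour_integral (C \<circ> linepath (fst p) (snd p)) f) contour_ends"
      using zero by eventually_elim simp
  qed
qed

text \<open>The sign \<open>\<epsilon>\<close> moves the line, seen from \<open>w\<close>, into the
  right half-plane, where the principal logarithm is a primitive of \<open>1 / (s - w)\<close>. Its
  imaginary part on the line is \<open>\<epsilon> * arctan (x / k)\<close>, with \<open>k\<close>
  the distance of \<open>w\<close> from the line, so the argument changes by
  \<open>\<epsilon> * pi\<close> in total.\<close>

lemma winding_number_vertical:
  assumes "w \<in> \<real>" "Re w \<noteq> g"
  shows "((\<lambda>p. Re (winding_number (linepath (Complex g (fst p)) (Complex g (snd p))) w)) \<longlongrightarrow>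
            sgn (g - Re w) / 2) contour_ends"
proof -
  define \<epsilon> where "\<epsilon> = sgn (g - Re w)"
  have \<epsilon>: "\<epsilon> * (g - Re w) > 0" "\<epsilon> = 1 \<or> \<epsilon> = - 1"
    using assms(2) by (auto simp: \<epsilon>_def sgn_if)
  have w: "w = of_real (Re w)"
    using assms(1) by (simp add: complex_is_Real_iff complex_eq_iff)
  define k where "k = \<bar>g - Re w\<bar>"
  have k: "k > 0" using assms(2) by (simp add: k_def)
  let ?L = "\<lambda>s. Ln (of_real \<epsilon> * (s - w))"
  have eq: "Re (winding_number (linepath (Complex g S) (Complex g T)) w) = \<epsilon> * (arctan (T / k) - arctan (S / k)) / (2 * pi)" for S T
  proof -
    let ?A = "{s. Re (of_real \<epsilon> * (s - w)) > 0}"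
    have seg: "closed_segment (Complex g S) (Complex g T) \<subseteq> ?A"
      using closed_segment_vertical[of _ g S T] \<epsilon> by auto
    have "((\<lambda>s. 1 / (s - w)) has_contour_integral ?L (pathfinish (linepath (Complex g S) (Complex g T))) -
        ?L (pathstart (linepath (Complex g S) (Complex g T)))) (linepath (Complex g S) (Complex g T))"
    proof (rule contour_integral_primitive)
      fix s assume "s \<in> ?A"
      then have "of_real \<epsilon> * (s - w) \<notin> \<real>\<^sub>\<le>\<^sub>0" "of_real \<epsilon> * (s - w) \<noteq> 0"
        by (auto simp: complex_nonpos_Reals_iff)
      then show "(?L has_field_derivative 1 / (s - w)) (at s within ?A)"
        using \<epsilon>(2) by (auto intro!: derivative_eq_intros simp: field_simps)
    qed (use seg in auto)
    then have ci: "contour_integral (linepath (Complex g S) (Complex g T)) (\<lambda>s. 1 / (s - w)) =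
        ?L (Complex g T) - ?L (Complex g S)"
      by (simp add: contour_integral_unique)
    have "w \<notin> closed_segment (Complex g S) (Complex g T)"
      using seg by auto
    then have "winding_number (linepath (Complex g S) (Complex g T)) w =
        1 / (2 * pi * \<i>) * (?L (Complex g T) - ?L (Complex g S))"
      by (simp add: winding_number_valid_path ci)
    moreover have "Re (1 / (2 * pi * \<i>) * z) = Im z / (2 * pi)" for z
      by (simp add: Re_divide Im_divide power2_eq_square field_simps)
    ultimately have "Re (winding_number (linepath (Complex g S) (Complex g T)) w) =
        (Im (?L (Complex g T)) - Im (?L (Complex g S))) / (2 * pi)"
      by (simp only: minus_complex.simps)
    moreover have "Im (?L (Complex g x)) = \<epsilon> * arctan (x / k)" for x
    proof -
      let ?z = "of_real \<epsilon> * (Complex g x - w)"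
      have z: "Re ?z = k" "Im ?z = \<epsilon> * x"
        using \<epsilon> assms(1) by (auto simp: k_def complex_is_Real_iff)
      then have "Im (Ln ?z) = arctan (Im ?z / Re ?z)"
        using k by (subst Im_Ln_eq) auto
      also have "\<dots> = arctan (\<epsilon> * (x / k))"
        by (simp only: z times_divide_eq_right)
      also have "\<dots> = \<epsilon> * arctan (x / k)"
        using \<epsilon>(2) by (auto simp: arctan_minus)
      finally show ?thesis .
    qed
    ultimately show ?thesis
      by (simp only: right_diff_distrib)
  qed
  have "filterlim (\<lambda>p. snd p / k) at_top contour_ends" "filterlim (\<lambda>p. fst p / k) at_bot contour_ends"
    using k filterlim_snd_contour_ends filterlim_fst_contour_ends
    by (auto simp: divide_inverse intro!: filterlim_at_top_mult_tendsto_pos filterlim_tendsto_pos_mult_at_bot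
       simp: mult.commute[of _ "inverse k"] intro!: filterlim_tendsto_pos_mult_at_top)
  then have "((\<lambda>p. \<epsilon> * (arctan (snd p / k) - arctan (fst p / k)) / (2 * pi)) \<longlongrightarrow>
      \<epsilon> * (pi / 2 - - (pi / 2)) / (2 * pi)) contour_ends"
    by (intro tendsto_intros filterlim_compose[OF tendsto_arctan_at_top] filterlim_compose[OF tendsto_arctan_at_bot]) auto
  then show ?thesis
    by (simp add: eq \<epsilon>_def)
qed

section \<open>Gamma factors in vertical strips\<close>

text \<open>The poles to be dealt with are real, so the restriction \<open>1 \<le> |Im s|\<close>
  admits functions with poles in the strip.\<close>

definition strip_bounded :: "(complex \<Rightarrow> complex) \<Rightarrow> bool" where
  "strip_bounded f \<longleftrightarrow> (\<forall>R. \<exists>K. \<forall>s. \<bar>Re s\<bar> \<le> R \<longrightarrow> 1 \<le> \<bar>Im s\<bar> \<longrightarrow> norm (f s) \<le> K)"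

text \<open>This rate is enough for the integrals over horizontal segments of bounded length to
  vanish in the limit. In a product, one decaying factor among bounded ones suffices.\<close>

definition strip_decay :: "(complex \<Rightarrow> complex) \<Rightarrow> bool" where
  "strip_decay f \<longleftrightarrow> (\<forall>R. \<exists>K. \<forall>s. \<bar>Re s\<bar> \<le> R \<longrightarrow> 1 \<le> \<bar>Im s\<bar> \<longrightarrow> norm (f s) \<le> K / \<bar>Im s\<bar>)"

lemma strip_decay_mult:
  assumes "strip_decay f" "strip_bounded g"
  shows "strip_decay (\<lambda>s. f s * g s)"
  unfolding strip_decay_def
proof
  fix R
  obtain K where K: "\<And>s. \<bar>Re s\<bar> \<le> R \<Longrightarrow> 1 \<le> \<bar>Im s\<bar> \<Longrightarrow> norm (f s) \<le> K / \<bar>Im s\<bar>"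
    using assms(1) unfolding strip_decay_def by blast
  obtain K' where K': "\<And>s. \<bar>Re s\<bar> \<le> R \<Longrightarrow> 1 \<le> \<bar>Im s\<bar> \<Longrightarrow> norm (g s) \<le> K'"
    using assms(2) unfolding strip_bounded_def by blast
  have "norm (f s * g s) \<le> K * K' / \<bar>Im s\<bar>" if "\<bar>Re s\<bar> \<le> R" "1 \<le> \<bar>Im s\<bar>" for s
    using mult_mono'[OF K[OF that] K'[OF that]] by (simp add: norm_mult)
  then show "\<exists>K. \<forall>s. \<bar>Re s\<bar> \<le> R \<longrightarrow> 1 \<le> \<bar>Im s\<bar> \<longrightarrow> norm (f s * g s) \<le> K / \<bar>Im s\<bar>"
    by blast
qed

lemma strip_bounded_mult:
  assumes "strip_bounded f" "strip_bounded g"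
  shows "strip_bounded (\<lambda>s. f s * g s)"
  unfolding strip_bounded_def
proof
  fix R
  obtain K where K: "\<And>s. \<bar>Re s\<bar> \<le> R \<Longrightarrow> 1 \<le> \<bar>Im s\<bar> \<Longrightarrow> norm (f s) \<le> K"
    using assms(1) unfolding strip_bounded_def by blast
  obtain K' where K': "\<And>s. \<bar>Re s\<bar> \<le> R \<Longrightarrow> 1 \<le> \<bar>Im s\<bar> \<Longrightarrow> norm (g s) \<le> K'"
    using assms(2) unfolding strip_bounded_def by blast
  have "norm (f s * g s) \<le> K * K'" if "\<bar>Re s\<bar> \<le> R" "1 \<le> \<bar>Im s\<bar>" for s
    using mult_mono'[OF K[OF that] K'[OF that]] by (simp add: norm_mult)
  then show "\<exists>K. \<forall>s. \<bar>Re s\<bar> \<le> R \<longrightarrow> 1 \<le> \<bar>Im s\<bar> \<longrightarrow> norm (f s * g s) \<le> K"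
    by blast
qed

lemma strip_decay_imp_bounded:
  assumes "strip_decay f"
  shows "strip_bounded f"
  unfolding strip_bounded_def
proof
  fix R
  obtain K where K: "\<And>s. \<bar>Re s\<bar> \<le> R \<Longrightarrow> 1 \<le> \<bar>Im s\<bar> \<Longrightarrow> norm (f s) \<le> K / \<bar>Im s\<bar>"
    using assms unfolding strip_decay_def by blast
  have "norm (f s) \<le> \<bar>K\<bar>" if "\<bar>Re s\<bar> \<le> R" "1 \<le> \<bar>Im s\<bar>" for s
  proof -
    have "norm (f s) * 1 \<le> norm (f s) * \<bar>Im s\<bar>"
      using that by (intro mult_left_mono) auto
    also have "\<dots> \<le> K"
      using K[OF that] that by (simp add: field_simps)
    finally show ?thesis by simp
  qed
  then show "\<exists>K. \<forall>s. \<bar>Re s\<bar> \<le> R \<longrightarrow> 1 \<le> \<bar>Im s\<bar> \<longrightarrow> norm (f s) \<le> K"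
    by blast
qed

lemma strip_bounded_prod:
  assumes "\<And>j. j \<in> J \<Longrightarrow> strip_bounded (f j)"
  shows "strip_bounded (\<lambda>s. \<Prod>j\<in>J. f j s)"
  using assms
proof (induction J rule: infinite_finite_induct)
  case (insert j J)
  then show ?case by (simp add: strip_bounded_mult)
qed (auto simp: strip_bounded_def)

lemma strip_decay_prod:
  assumes "finite J" "j \<in> J" "\<And>j. j \<in> J \<Longrightarrow> strip_decay (f j)"
  shows "strip_decay (\<lambda>s. \<Prod>j\<in>J. f j s)"
  unfolding prod.remove[OF assms(1,2)] using assms
  by (intro strip_decay_mult strip_bounded_prod strip_decay_imp_bounded) auto

lemma strip_bounded_powr:
  assumes "t > 0"
  shows "strip_bounded (\<lambda>s. of_real t powr (- s))"
  unfolding strip_bounded_def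
proof
  fix R
  have "norm (of_real t powr (- s)) \<le> exp (R * \<bar>ln t\<bar>)" if "\<bar>Re s\<bar> \<le> R" for s
  proof -
    have "norm (of_real t powr (- s)) = exp (- Re s * ln t)"
      using assms by (simp add: norm_powr_real_powr powr_def)
    also have "- Re s * ln t \<le> \<bar>Re s\<bar> * \<bar>ln t\<bar>"
      using abs_ge_self[of "- Re s * ln t"] by (simp add: abs_mult)
    also have "\<dots> \<le> R * \<bar>ln t\<bar>"
      using that by (intro mult_right_mono) auto
    finally show ?thesis by simp
  qed
  then show "\<exists>K. \<forall>s. \<bar>Re s\<bar> \<le> R \<longrightarrow> 1 \<le> \<bar>Im s\<bar> \<longrightarrow> norm (of_real t powr (- s)) \<le> K"
    by blast
qed

lemma pochhammer_ge_Im: "\<bar>Im z\<bar> ^ k \<le> norm (pochhammer z k)" for z :: complex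
proof -
  have "(\<Prod>i=0..<k. \<bar>Im z\<bar>) \<le> (\<Prod>i=0..<k. norm (z + of_nat i))"
  proof (rule prod_mono)
    fix i
    show "0 \<le> \<bar>Im z\<bar> \<and> \<bar>Im z\<bar> \<le> norm (z + of_nat i)"
      using abs_Im_le_cmod[of "z + of_nat i"] by simp
  qed
  then show ?thesis
    by (simp add: pochhammer_prod prod_norm)
qed

lemma Gamma_shift:
  assumes "Im z \<noteq> 0"
  shows "Gamma z = Gamma (z + of_nat k) / pochhammer z k" "pochhammer z k \<noteq> 0"
proof -
  have z: "z \<notin> \<int>\<^sub>\<le>\<^sub>0"
    using assms by (auto elim!: nonpos_Ints_cases)
  then show nz: "pochhammer z k \<noteq> 0"
    by (auto simp: pochhammer_eq_0_iff)
  have "Gamma z * pochhammer z k = Gamma (z + of_nat k)"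
    using pochhammer_Gamma[OF z, of k] Gamma_nonzero[OF z] by simp
  then show "Gamma z = Gamma (z + of_nat k) / pochhammer z k"
    using nz by (simp add: eq_divide_eq)
qed

text \<open>The shift \<open>k\<close> moves the image of the strip into the right half-plane, where
  the bounds from Euler's integrals apply. The summand 1 in \<open>k\<close> makes \<open>x0\<close>
  strictly positive and guarantees at least one factor in the Pochhammer symbol, that is, one power
  of decay.\<close>

lemma strip_shift:
  fixes \<beta> B R :: real
  obtains k :: nat and x0 x1 where "k \<ge> 1" "x0 > 0"
    "\<And>s. \<bar>Re s\<bar> \<le> R \<Longrightarrow> Re (of_real \<beta> + of_real B * s + of_nat k) \<in> {x0..x1}"
proof -
  define k where "k = nat \<lceil>\<bar>B\<bar> * R - \<beta>\<rceil> + 1"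
  have k: "real k > \<bar>B\<bar> * R - \<beta>"
    unfolding k_def by linarith
  have bnd: "\<bar>B * Re s\<bar> \<le> \<bar>B\<bar> * R" if "\<bar>Re s\<bar> \<le> R" for s
    using that by (simp add: abs_mult mult_left_mono)
  show ?thesis
  proof (rule that[of k "\<beta> - \<bar>B\<bar> * R + real k" "\<beta> + \<bar>B\<bar> * R + real k"])
    show "Re (of_real \<beta> + of_real B * s + of_nat k) \<in> {\<beta> - \<bar>B\<bar> * R + real k..\<beta> + \<bar>B\<bar> * R + real k}" if "\<bar>Re s\<bar> \<le> R" for s
      using bnd[OF that] by (auto simp: abs_le_iff)
  qed (use k in \<open>auto simp: k_def\<close>)
qed

text \<open>In \<open>Gamma z = Gamma (z + k) / pochhammer z k\<close> the numerator is bounded,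
  because its real part stays in a compact interval of positive numbers, and every factor of the
  denominator has modulus at least \<open>|B * Im s|\<close>. The sign of \<open>B\<close> is free,
  since upper parameters contribute negative slopes.\<close>

lemma strip_decay_Gamma:
  fixes \<beta> B :: real
  assumes "B \<noteq> 0"
  shows "strip_decay (\<lambda>s. Gamma (of_real \<beta> + of_real B * s))"
  unfolding strip_decay_def
proof
  fix R :: real
  obtain k x0 x1 where k: "k \<ge> 1" "x0 > 0"
    "\<And>s. \<bar>Re s\<bar> \<le> R \<Longrightarrow> Re (of_real \<beta> + of_real B * s + of_nat k) \<in> {x0..x1}"
    using strip_shift[of R \<beta> B] by metis
  have "compact (Gamma ` {x0..x1})"
    using k(2) by (intro compact_continuous_image continuous_on_Gamma) (auto elim!: nonpos_Ints_cases)
  then have "bounded (Gamma ` {x0..x1})"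
    by (rule compact_imp_bounded)
  then obtain M where "\<forall>x\<in>Gamma ` {x0..x1}. norm x \<le> M"
    unfolding bounded_iff ..
  then have M: "\<bar>Gamma x\<bar> \<le> M" if "x \<in> {x0..x1}" for x
    using that by simp
  have "norm (Gamma (of_real \<beta> + of_real B * s)) \<le> (M / \<bar>B\<bar> ^ k) / \<bar>Im s\<bar>"
    if s: "\<bar>Re s\<bar> \<le> R" "1 \<le> \<bar>Im s\<bar>" for s
  proof -
    let ?z = "of_real \<beta> + of_real B * s"
    have Im: "Im ?z \<noteq> 0"
      using assms s by auto
    have "norm (Gamma (?z + of_nat k)) \<le> Gamma (Re (?z + of_nat k))"
      using k(2,3) s(1) by (intro norm_Gamma_le) force
    also have "\<dots> \<le> M"
      using M[OF k(3)[OF s(1)]] by simp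
    finally have 1: "norm (Gamma (?z + of_nat k)) \<le> M" .
    have "\<bar>B\<bar> ^ k * \<bar>Im s\<bar> \<le> \<bar>B\<bar> ^ k * \<bar>Im s\<bar> ^ k"
      using s(2) k(1) by (intro mult_left_mono self_le_power) auto
    also have "\<dots> \<le> norm (pochhammer ?z k)"
      using pochhammer_ge_Im[of ?z k] by (simp add: abs_mult power_mult_distrib)
    finally have 2: "\<bar>B\<bar> ^ k * \<bar>Im s\<bar> \<le> norm (pochhammer ?z k)" .
    have "norm (Gamma ?z) = norm (Gamma (?z + of_nat k)) / norm (pochhammer ?z k)"
      using Gamma_shift(1)[OF Im, of k] by (simp add: norm_divide)
    also have "\<dots> \<le> M / (\<bar>B\<bar> ^ k * \<bar>Im s\<bar>)"
      using 1 2 assms s(2) by (intro frac_le order_trans[OF norm_ge_zero 1]) auto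
    finally show ?thesis by simp
  qed
  then show "\<exists>K. \<forall>s. \<bar>Re s\<bar> \<le> R \<longrightarrow> 1 \<le> \<bar>Im s\<bar> \<longrightarrow> norm (Gamma (of_real \<beta> + of_real B * s)) \<le> K / \<bar>Im s\<bar>"
    by blast
qed

text \<open>Each factor of the quotient is \<open>1 + \<delta> / (z + i)\<close>, and
  \<open>|z + i| \<ge> |Im z|\<close>.\<close>

lemma pochhammer_ratio_bound:
  fixes z :: complex
  assumes "Im z \<noteq> 0" "\<delta> \<ge> 0"
  shows "norm (pochhammer (z + of_real \<delta>) k / pochhammer z k) \<le> (1 + \<delta> / \<bar>Im z\<bar>) ^ k"
proof -
  have "norm (pochhammer (z + of_real \<delta>) k / pochhammer z k) =
      (\<Prod>i=0..<k. norm ((z + of_real \<delta> + of_nat i) / (z + of_nat i)))"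
    by (simp add: pochhammer_prod prod_dividef prod_norm flip: norm_divide)
  also have "\<dots> \<le> (\<Prod>i=0..<k. 1 + \<delta> / \<bar>Im z\<bar>)"
  proof (rule prod_mono, intro conjI)
    fix i
    have "z + of_nat i \<noteq> 0"
      using assms(1) by (auto simp: complex_eq_iff)
    then have "norm ((z + of_real \<delta> + of_nat i) / (z + of_nat i)) = norm (1 + of_real \<delta> / (z + of_nat i))"
      by (simp add: field_simps)
    also have "\<dots> \<le> 1 + \<delta> / norm (z + of_nat i)"
      using norm_triangle_ineq[of 1 "of_real \<delta> / (z + of_nat i)"] assms(2) by (simp add: norm_divide)
    also have "\<dots> \<le> 1 + \<delta> / \<bar>Im z\<bar>"
      using abs_Im_le_cmod[of "z + of_nat i"] assms by (simp add: frac_le)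
    finally show "norm ((z + of_real \<delta> + of_nat i) / (z + of_nat i)) \<le> 1 + \<delta> / \<bar>Im z\<bar>" .
  qed simp
  finally show ?thesis by simp
qed

text \<open>Shifting numerator and denominator by the same \<open>k\<close> leaves a quotient of
  Pochhammer symbols, which is bounded away from the real axis. Decay is left to the Gamma factors
  without a partner in the denominator.\<close>

lemma strip_bounded_Gamma_ratio:
  fixes \<beta> B :: real
  assumes "B \<noteq> 0" "\<delta> > 0"
  shows "strip_bounded (\<lambda>s. Gamma (of_real \<beta> + of_real B * s) * rGamma (of_real (\<beta> + \<delta>) + of_real B * s))"
  unfolding strip_bounded_def
proof
  fix R :: real
  obtain k x0 x1 where k: "k \<ge> 1" "x0 > 0"
    "\<And>s. \<bar>Re s\<bar> \<le> R \<Longrightarrow> Re (of_real \<beta> + of_real B * s + of_nat k) \<in> {x0..x1}"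
    using strip_shift[of R \<beta> B] by metis
  let ?G = "\<lambda>x. Gamma x / Gamma (x + \<delta>)"
  have "compact (?G ` {x0..x1})"
    using k(2) assms(2)
    by (intro compact_continuous_image continuous_intros continuous_on_compose2[OF continuous_on_Gamma[of "{0<..}"]])
       (auto elim!: nonpos_Ints_cases simp: Gamma_eq_zero_iff)
  then have "bounded (?G ` {x0..x1})"
    by (rule compact_imp_bounded)
  then obtain M where "\<forall>x\<in>?G ` {x0..x1}. norm x \<le> M"
    unfolding bounded_iff ..
  then have M: "\<bar>?G x\<bar> \<le> M" if "x \<in> {x0..x1}" for x
    using that by fastforce
  have "norm (Gamma (of_real \<beta> + of_real B * s) * rGamma (of_real (\<beta> + \<delta>) + of_real B * s)) \<le> (1 + \<delta> / \<bar>B\<bar>) ^ k * M"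
    if s: "\<bar>Re s\<bar> \<le> R" "1 \<le> \<bar>Im s\<bar>" for s
  proof -
    let ?z = "of_real \<beta> + of_real B * s"
    have Im: "Im ?z \<noteq> 0"
      using assms s by auto
    have "norm (Gamma (?z + of_nat k) * rGamma (?z + of_nat k + of_real \<delta>)) \<le> ?G (Re (?z + of_nat k))"
      using k(2,3) s(1) assms(2) by (intro norm_Gamma_ratio_le) force+
    also have "\<dots> \<le> M"
      by (rule abs_le_D1[OF M[OF k(3)[OF s(1)]]])
    finally have 1: "norm (Gamma (?z + of_nat k) * rGamma (?z + of_nat k + of_real \<delta>)) \<le> M" .
    have "\<bar>B\<bar> * 1 \<le> \<bar>B\<bar> * \<bar>Im s\<bar>"
      using s by (intro mult_left_mono) auto
    then have "\<bar>B\<bar> \<le> \<bar>Im ?z\<bar>"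
      by (simp add: abs_mult)
    then have "1 + \<delta> / \<bar>Im ?z\<bar> \<le> 1 + \<delta> / \<bar>B\<bar>"
      using assms by (auto intro: frac_le)
    then have "(1 + \<delta> / \<bar>Im ?z\<bar>) ^ k \<le> (1 + \<delta> / \<bar>B\<bar>) ^ k"
      using assms(2) by (intro power_mono) auto
    then have 2: "norm (pochhammer (?z + of_real \<delta>) k / pochhammer ?z k) \<le> (1 + \<delta> / \<bar>B\<bar>) ^ k"
      using pochhammer_ratio_bound[OF Im, of \<delta> k] assms(2) by linarith
    have eq: "of_real (\<beta> + \<delta>) + of_real B * s = ?z + of_real \<delta>" "?z + of_real \<delta> + of_nat k = ?z + of_nat k + of_real \<delta>"
      by simp_all
    have "Gamma ?z * rGamma (?z + of_real \<delta>) = (pochhammer (?z + of_real \<delta>) k / pochhammer ?z k) *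
        (Gamma (?z + of_nat k) * rGamma (?z + of_nat k + of_real \<delta>))"
      using Gamma_shift(1)[OF Im, of k] pochhammer_rGamma[of "?z + of_real \<delta>" k] unfolding eq(2) by simp
    also have "norm \<dots> \<le> (1 + \<delta> / \<bar>B\<bar>) ^ k * M"
      using mult_mono'[OF 2 1] by (simp only: norm_mult norm_ge_zero mult_nonneg_nonneg)
    finally show ?thesis unfolding eq(1) .
  qed
  then show "\<exists>K. \<forall>s. \<bar>Re s\<bar> \<le> R \<longrightarrow> 1 \<le> \<bar>Im s\<bar> \<longrightarrow>
      norm (Gamma (of_real \<beta> + of_real B * s) * rGamma (of_real (\<beta> + \<delta>) + of_real B * s)) \<le> K"
    by blast
qed

section \<open>Poles of Gamma with an affine argument\<close>

text \<open>One description for both families of poles: a lower parameter gives the pair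
  \<open>\<beta>\<close>, \<open>B\<close>, an upper one the pair \<open>1 - \<alpha>\<close>,
  \<open>- A\<close>.\<close>

definition Gamma_pole_set :: "real \<Rightarrow> real \<Rightarrow> complex set" where
  "Gamma_pole_set \<beta> B = {s. of_real \<beta> + of_real B * s \<in> \<int>\<^sub>\<le>\<^sub>0}"

lemma Gamma_pole_set_cases:
  assumes "s \<in> Gamma_pole_set \<beta> B" "B \<noteq> 0"
  obtains n where "s = of_real ((- real n - \<beta>) / B)"
proof -
  obtain n where "of_real \<beta> + of_real B * s = - of_nat n"
    using assms(1) by (auto simp: Gamma_pole_set_def elim!: nonpos_Ints_cases')
  then have "of_real B * s = of_real (- real n - \<beta>)"
    by (simp add: algebra_simps eq_neg_iff_add_eq_0)
  then have "s = of_real ((- real n - \<beta>) / B)"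
    using assms(2) by (simp add: field_simps)
  then show ?thesis by (rule that)
qed

lemma closed_Gamma_pole_set: "closed (Gamma_pole_set \<beta> B)"
proof -
  have "Gamma_pole_set \<beta> B = (\<lambda>s. of_real \<beta> + of_real B * s) -` \<int>\<^sub>\<le>\<^sub>0"
    by (auto simp: Gamma_pole_set_def)
  also have "closed \<dots>"
    by (rule closed_vimage[OF closed_subset_Ints[OF nonpos_Ints_subset_Ints]]) (intro continuous_intros)
  finally show ?thesis .
qed

lemma Gamma_pole_set_Reals:
  assumes "B \<noteq> 0"
  shows "Gamma_pole_set \<beta> B \<subseteq> \<real>"
  using assms by (auto elim!: Gamma_pole_set_cases)

lemma finite_Gamma_pole_set_strip:
  assumes "B \<noteq> 0"
  shows "finite {w \<in> Gamma_pole_set \<beta> B. \<bar>Re w\<bar> \<le> R}"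
proof (rule finite_subset)
  show "{w \<in> Gamma_pole_set \<beta> B. \<bar>Re w\<bar> \<le> R} \<subseteq>
      (\<lambda>n. of_real ((- real n - \<beta>) / B)) ` {..nat \<lceil>\<bar>B\<bar> * R + \<bar>\<beta>\<bar>\<rceil>}"
  proof
    fix w assume w: "w \<in> {w \<in> Gamma_pole_set \<beta> B. \<bar>Re w\<bar> \<le> R}"
    then obtain n where n: "w = of_real ((- real n - \<beta>) / B)"
      using assms by (auto elim: Gamma_pole_set_cases)
    then have "\<bar>- real n - \<beta>\<bar> / \<bar>B\<bar> \<le> R"
      using w by (simp only: Re_complex_of_real mem_Collect_eq flip: abs_divide)
    then have "\<bar>- real n - \<beta>\<bar> \<le> \<bar>B\<bar> * R"
      using assms by (simp only: pos_divide_le_eq[of "\<bar>B\<bar>"] zero_less_abs_iff mult.commute not_False_eq_True simp_thms)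
    then have "real n \<le> \<bar>B\<bar> * R + \<bar>\<beta>\<bar>" by linarith
    then have "n \<le> nat \<lceil>\<bar>B\<bar> * R + \<bar>\<beta>\<bar>\<rceil>" by linarith
    then show "w \<in> (\<lambda>n. of_real ((- real n - \<beta>) / B)) ` {..nat \<lceil>\<bar>B\<bar> * R + \<bar>\<beta>\<bar>\<rceil>}"
      using n by auto
  qed
qed simp

text \<open>For \<open>B > 0\<close> this bounds the poles from the right, for \<open>B < 0\<close>
  from the left.\<close>

lemma Gamma_pole_set_Re:
  assumes "s \<in> Gamma_pole_set \<beta> B" "B \<noteq> 0"
  shows "B * Re s \<le> - \<beta>"
  using assms by (auto elim!: Gamma_pole_set_cases)

lemma holomorphic_Gamma_affine:
  assumes "A \<inter> Gamma_pole_set \<beta> B = {}"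
  shows "(\<lambda>s. Gamma (of_real \<beta> + of_real B * s)) holomorphic_on A"
  using assms by (intro holomorphic_intros) (auto simp: Gamma_pole_set_def)

lemma is_pole_Gamma_affine_iff:
  assumes "B \<noteq> 0"
  shows "is_pole (\<lambda>s. Gamma (of_real \<beta> + of_real B * s)) w \<longleftrightarrow> w \<in> Gamma_pole_set \<beta> B"
proof
  assume pole: "is_pole (\<lambda>s. Gamma (of_real \<beta> + of_real B * s)) w"
  show "w \<in> Gamma_pole_set \<beta> B"
  proof (rule ccontr)
    assume "w \<notin> Gamma_pole_set \<beta> B"
    then have "\<not> is_pole (\<lambda>s. Gamma (of_real \<beta> + of_real B * s)) w"
      by (intro not_is_pole_holomorphic[of "- Gamma_pole_set \<beta> B"] holomorphic_Gamma_affine)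
        (auto simp: closed_Gamma_pole_set open_Compl)
    then show False using pole by blast
  qed
next
  assume w: "w \<in> Gamma_pole_set \<beta> B"
  then obtain n where n: "of_real \<beta> + of_real B * w = - of_nat n"
    by (auto simp: Gamma_pole_set_def elim!: nonpos_Ints_cases')
  show "is_pole (\<lambda>s. Gamma (of_real \<beta> + of_real B * s)) w"
  proof (rule is_pole_compose[OF is_pole_Gamma[of n]])
    show "((\<lambda>s. of_real \<beta> + of_real B * s) \<longlongrightarrow> - of_nat n) (at w)"
      unfolding n[symmetric] by (intro tendsto_intros)
    show "eventually (\<lambda>s. of_real \<beta> + of_real B * s \<noteq> - of_nat n) (at w)"
      unfolding n[symmetric] using assms by (auto simp: eventually_at intro: exI[of _ 1])
  qed
qed

section \<open>Gamma factors on a vertical line\<close>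

text \<open>Defined by its action instead of by a representing measure, so that products of
  multipliers need no convolution of measures; a multiplier need not be integrable.\<close>

definition fourier_multiplier :: "(real \<Rightarrow> complex) \<Rightarrow> bool" where
  "fourier_multiplier g \<longleftrightarrow> (\<forall>f. fourier_pos f \<longrightarrow> fourier_pos (\<lambda>y. f y * g y))"

lemma fourier_multiplier_mult:
  assumes "fourier_multiplier f" "fourier_multiplier g"
  shows "fourier_multiplier (\<lambda>y. f y * g y)"
  using assms by (auto simp: fourier_multiplier_def mult.assoc[symmetric])

lemma fourier_multiplier_prod:
  assumes "\<And>j. j \<in> J \<Longrightarrow> fourier_multiplier (f j)"
  shows "fourier_multiplier (\<lambda>y. \<Prod>j\<in>J. f j y)"
  using assms
proof (induction J rule: infinite_finite_induct)
  case (insert j J)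
  then show ?case by (simp add: fourier_multiplier_mult)
qed (auto simp: fourier_multiplier_def)

lemma fourier_pos_prod:
  assumes "finite J" "j \<in> J" "fourier_pos (f j)" "\<And>j. j \<in> J \<Longrightarrow> fourier_multiplier (f j)"
  shows "fourier_pos (\<lambda>y. \<Prod>j\<in>J. f j y)"
  unfolding prod.remove[OF assms(1,2)]
  using assms(3) fourier_multiplier_prod[of "J - {j}" f] assms(4) by (auto simp: fourier_multiplier_def)

lemma vertical_affine:
  "of_real \<beta> + of_real B * Complex g y = Complex (\<beta> + B * g) (B * y)"
  by (simp add: complex_eq_iff)

text \<open>The slope enters only through \<open>\<phi> x = B * ln x\<close>, so its sign is free
  and the factors of upper parameters are covered.\<close>

lemma fourier_multiplier_Gamma:
  assumes "\<beta> + B * g > 0"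
  shows "fourier_multiplier (\<lambda>y. Gamma (of_real \<beta> + of_real B * Complex g y))"
  unfolding fourier_multiplier_def
proof (intro allI impI)
  fix f assume f: "fourier_pos f"
  have "fourier_pos (\<lambda>y. f y * (CLBINT x. of_real (gamma_weight (\<beta> + B * g) x) * cis (y * (B * ln x))))"
    using assms f
    by (intro fourier_pos_mult) (auto simp: integrable_gamma_weight integral_gamma_weight gamma_weight_nonneg Gamma_real_pos)
  moreover have "(CLBINT x. of_real (gamma_weight (\<beta> + B * g) x) * cis (y * (B * ln x))) =
      Gamma (of_real \<beta> + of_real B * Complex g y)" for y
    using has_bochner_integral_Gamma[OF assms, of "B * y"]
    by (simp add: vertical_affine has_bochner_integral_iff mult_ac)
  ultimately show "fourier_pos (\<lambda>y. f y * Gamma (of_real \<beta> + of_real B * Complex g y))"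
    by simp
qed

lemma fourier_multiplier_Gamma_ratio:
  assumes "\<beta> + B * g > 0" "\<delta> > 0"
  shows "fourier_multiplier (\<lambda>y. Gamma (of_real \<beta> + of_real B * Complex g y) *
           rGamma (of_real (\<beta> + \<delta>) + of_real B * Complex g y))"
  unfolding fourier_multiplier_def
proof (intro allI impI)
  fix f assume f: "fourier_pos f"
  have "Gamma \<delta> > 0" "Beta (\<beta> + B * g) \<delta> > 0"
    using assms by (auto simp: Beta_def Gamma_real_pos)
  then have "fourier_pos (\<lambda>y. f y * (CLBINT x. of_real (beta_weight (\<beta> + B * g) \<delta> x / Gamma \<delta>) * cis (y * (B * ln x))))"
    using assms f
    by (intro fourier_pos_mult) (auto simp: integrable_beta_weight integral_beta_weight beta_weight_nonneg)
  moreover have "(CLBINT x. of_real (beta_weight (\<beta> + B * g) \<delta> x / Gamma \<delta>) * cis (y * (B * ln x))) =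
      Gamma (of_real \<beta> + of_real B * Complex g y) * rGamma (of_real (\<beta> + \<delta>) + of_real B * Complex g y)" for y
  proof -
    have "(CLBINT x. of_real (beta_weight (\<beta> + B * g) \<delta> x / Gamma \<delta>) * cis (y * (B * ln x))) =
        (CLBINT x. of_real (beta_weight (\<beta> + B * g) \<delta> x / Gamma \<delta>) * cis (B * y * ln x))"
      by (simp add: mult_ac)
    also have "\<dots> = Gamma (Complex (\<beta> + B * g) (B * y)) * rGamma (Complex (\<beta> + B * g + \<delta>) (B * y))"
      by (rule Gamma_ratio_eq_integral[symmetric]) (use assms in auto)
    finally show ?thesis
      by (simp only: vertical_affine add_ac)
  qed
  ultimately show "fourier_pos (\<lambda>y. f y * (Gamma (of_real \<beta> + of_real B * Complex g y) *
           rGamma (of_real (\<beta> + \<delta>) + of_real B * Complex g y)))"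
    by (simp only:)
qed

lemma fourier_pos_Gamma_line:
  assumes "\<beta> + B * g > 0" "B > 0"
  shows "fourier_pos (\<lambda>y. Gamma (of_real \<beta> + of_real B * Complex g y))"
  using fourier_pos_Gamma[OF assms] by (simp add: vertical_affine)

section \<open>Improper integrals along a vertical line\<close>

lemma lessThan_insert:
  "insert y {..<y} = {..y}" for y :: real
  by auto

lemma atLeastAtMost_eq_insert:
  "x \<le> y \<Longrightarrow> {x..y} = insert x {x<..y}" for x y :: real
  by auto

lemma integral_indicator_insert:
  fixes f :: "real \<Rightarrow> 'a :: {banach, second_countable_topology}"
  assumes [measurable]: "f \<in> borel_measurable borel" "A \<in> sets borel"
  shows "(LBINT x. indicator (insert a A) x *\<^sub>R f x) = (LBINT x. indicator A x *\<^sub>R f x)"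
proof (rule integral_cong_AE)
  show "AE x in lborel. indicator (insert a A) x *\<^sub>R f x = indicator A x *\<^sub>R f x"
    using AE_lborel_singleton[of a] by eventually_elim (simp add: indicator_def)
qed measurable

text \<open>The integral over an interval is a difference of two values of \<open>I\<close>, so the
  two ends can be treated separately.\<close>

lemma tendsto_integral_contour_ends:
  fixes f :: "real \<Rightarrow> complex"
  assumes f: "integrable lborel f"
  shows "((\<lambda>p. integral {fst p..snd p} f) \<longlongrightarrow> integral\<^sup>L lborel f) contour_ends"
proof -
  define I where "I y = (CLBINT x. indicator {..y} x *\<^sub>R f x)" for y
  have int: "integrable lborel (\<lambda>x. indicator A x *\<^sub>R f x)" if "A \<in> sets borel" for A
    using f that integrable_mult_indicator[of A lborel f] by simp
  have top: "(I \<longlongrightarrow> integral\<^sup>L lborel f) at_top"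
    unfolding I_def using f by (intro tendsto_integral_at_top) auto
  \<comment> \<open>Reduced to the upper end by the reflection of the line. The complement of the
    reflected half-line is open; it differs from the closed one by a null set.\<close>
  have bot: "(I \<longlongrightarrow> 0) at_bot"
  proof -
    have int_minus: "integrable lborel (\<lambda>x. f (- x))"
      using lborel_integrable_real_affine[OF f, of "-1" 0] by simp
    have "I (- y) = integral\<^sup>L lborel f - (CLBINT x. indicator {..y} x *\<^sub>R f (- x))" for y
    proof -
      have "I (- y) = (CLBINT x. indicator {..- y} (- x) *\<^sub>R f (- x))"
        unfolding I_def using lborel_integral_real_affine[of "-1" "\<lambda>x. indicator {..- y} x *\<^sub>R f x" 0] by simp
      also have "\<dots> = (CLBINT x. f (- x) - indicator {..<y} x *\<^sub>R f (- x))"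
        by (intro Bochner_Integration.integral_cong) (auto simp: indicator_def)
      also have "\<dots> = (CLBINT x. f (- x)) - (CLBINT x. indicator {..<y} x *\<^sub>R f (- x))"
        using int_minus integrable_mult_indicator[of "{..<y}" lborel "\<lambda>x. f (- x)"]
        by (intro Bochner_Integration.integral_diff) auto
      also have "(CLBINT x. f (- x)) = integral\<^sup>L lborel f"
        using lborel_integral_real_affine[of "-1" f 0] by simp
      also have "(CLBINT x. indicator {..<y} x *\<^sub>R f (- x)) = (CLBINT x. indicator {..y} x *\<^sub>R f (- x))"
        using integral_indicator_insert[of "\<lambda>x. f (- x)" "{..<y}" y] int_minus
        by (simp add: lessThan_insert)
      finally show ?thesis .
    qed
    moreover have "((\<lambda>y. CLBINT x. indicator {..y} x *\<^sub>R f (- x)) \<longlongrightarrow> integral\<^sup>L lborel (\<lambda>x. f (- x))) at_top"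
      using int_minus by (intro tendsto_integral_at_top) auto
    moreover have "(CLBINT x. f (- x)) = integral\<^sup>L lborel f"
      using lborel_integral_real_affine[of "-1" f 0] by simp
    ultimately have "((\<lambda>y. I (- y)) \<longlongrightarrow> integral\<^sup>L lborel f - integral\<^sup>L lborel f) at_top"
      by (simp only:) (intro tendsto_intros)
    then show ?thesis
      by (simp add: filterlim_at_bot_mirror)
  qed
  have lim: "((\<lambda>p. I (snd p) - I (fst p)) \<longlongrightarrow> integral\<^sup>L lborel f - 0) contour_ends"
    by (intro tendsto_diff filterlim_compose[OF top] filterlim_compose[OF bot]
        filterlim_fst_contour_ends filterlim_snd_contour_ends)
  have "eventually (\<lambda>p. I (snd p) - I (fst p) = integral {fst p..snd p} f) contour_ends"
    using eventually_contour_ends_less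
  proof eventually_elim
    case (elim p)
    have "I (snd p) - I (fst p) = (CLBINT x. indicator {..snd p} x *\<^sub>R f x - indicator {..fst p} x *\<^sub>R f x)"
      unfolding I_def by (intro Bochner_Integration.integral_diff[symmetric] int) auto
    also have "\<dots> = (CLBINT x. indicator {fst p<..snd p} x *\<^sub>R f x)"
      using elim by (intro Bochner_Integration.integral_cong) (auto simp: indicator_def)
    also have "\<dots> = (CLBINT x. indicator {fst p..snd p} x *\<^sub>R f x)"
      using integral_indicator_insert[of f "{fst p<..snd p}" "fst p"] f elim
      by (simp add: atLeastAtMost_eq_insert)
    also have "\<dots> = integral {fst p..snd p} f"
      using set_borel_integral_eq_integral(2)[of "{fst p..snd p}" f] int
      by (simp add: set_integrable_def set_lebesgue_integral_def)
    finally show ?case .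
  qed
  from Lim_transform_eventually[OF lim this] show ?thesis by simp
qed

lemma contour_integral_vertical_tendsto:
  assumes "integrable lborel (\<lambda>y. f (Complex g y))"
  shows "((\<lambda>p. contour_integral (linepath (Complex g (fst p)) (Complex g (snd p))) f) \<longlongrightarrow>
           \<i> * (CLBINT y. f (Complex g y))) contour_ends"
proof (rule Lim_transform_eventually)
  show "((\<lambda>p. \<i> * integral {fst p..snd p} (\<lambda>y. f (Complex g y))) \<longlongrightarrow>
           \<i> * (CLBINT y. f (Complex g y))) contour_ends"
    by (intro tendsto_intros tendsto_integral_contour_ends assms)
  show "eventually (\<lambda>p. \<i> * integral {fst p..snd p} (\<lambda>y. f (Complex g y)) =
      contour_integral (linepath (Complex g (fst p)) (Complex g (snd p))) f) contour_ends"
    using eventually_contour_ends_less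
    by eventually_elim (simp add: contour_integral_linepath_same_Re)
qed

lemma contour_from_to_ii_infinity_vertical: "contour_from_to_ii_infinity g (Complex g)"
proof -
  have eq: "Complex g = (\<lambda>t. of_real g + \<i> * of_real t)"
    by (auto simp: complex_eq_iff)
  have "Complex g C1_differentiable_on A" for A
    unfolding eq by (intro derivative_intros)
  then show ?thesis
    by (auto simp: contour_from_to_ii_infinity_def inj_on_def filterlim_ident
        intro: C1_differentiable_imp_piecewise)
qed

lemma vertical_linepath: "Complex g \<circ> linepath S T = linepath (Complex g S) (Complex g T)"
  by (auto simp: linepath_def complex_eq_iff algebra_simps)

lemma left_of_contour_iff:
  "left_of_contour C w \<longleftrightarrow> w \<notin> range C \<and>
     ((\<lambda>p. Re (winding_number (C \<circ> linepath (fst p) (snd p)) w)) \<longlongrightarrow> 1 / 2) contour_ends"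
  and right_of_contour_iff:
  "right_of_contour C w \<longleftrightarrow> w \<notin> range C \<and>
     ((\<lambda>p. Re (winding_number (C \<circ> linepath (fst p) (snd p)) w)) \<longlongrightarrow> - 1 / 2) contour_ends"
  by (simp_all add: left_of_contour_def right_of_contour_def case_prod_unfold)

lemma left_of_vertical:
  assumes "w \<in> \<real>" "Re w < g"
  shows "left_of_contour (Complex g) w"
  using winding_number_vertical[of w g] assms
  by (auto simp: left_of_contour_iff vertical_linepath)

lemma right_of_vertical:
  assumes "w \<in> \<real>" "g < Re w"
  shows "right_of_contour (Complex g) w"
  using winding_number_vertical[of w g] assms
  by (auto simp: right_of_contour_iff vertical_linepath)

section \<open>The H-function as an integral over a vertical line\<close>

lemma prod_nth_take:
  fixes h :: "'a \<Rightarrow> 'b::comm_monoid_mult"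
  assumes "k \<le> length xs"
  shows "(\<Prod>j<k. h (xs ! j)) = prod_list (map h (take k xs))"
  using assms by (subst prod.list_conv_set_nth) (auto simp: atLeast0LessThan intro!: prod.cong)

lemma prod_nth_drop:
  fixes h :: "'a \<Rightarrow> 'b::comm_monoid_mult"
  shows "(\<Prod>j=k..<length xs. h (xs ! j)) = prod_list (map h (drop k xs))"
proof -
  have "prod_list (map h (drop k xs)) = (\<Prod>j=0..<length xs - k. h (xs ! (k + j)))"
    by (subst prod.list_conv_set_nth) (auto intro!: prod.cong)
  also have "\<dots> = (\<Prod>j=k..<length xs. h (xs ! j))"
  proof (cases "k \<le> length xs")
    case True
    then show ?thesis
      using prod.shift_bounds_nat_ivl[of "\<lambda>j. h (xs ! j)" 0 k "length xs - k"] by (simp add: add.commute)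
  qed simp
  finally show ?thesis ..
qed

lemma all_nth_take:
  "k \<le> length xs \<Longrightarrow> (\<forall>j<k. Q (xs ! j)) \<longleftrightarrow> (\<forall>x\<in>set (take k xs). Q x)"
  by (auto simp: all_set_conv_all_nth)

lemma prod_list_map_upt:
  fixes h :: "nat \<Rightarrow> 'b::comm_monoid_mult"
  shows "prod_list (map h [1..<Suc k]) = (\<Prod>j\<in>{1..k}. h j)"
  by (simp add: prod.distinct_set_conv_list[symmetric] atLeastLessThanSuc_atLeastAtMost del: upt_Suc)

text \<open>By \<open>lo\<close> and \<open>up\<close> the Gamma factors of the numerator have
  arguments with positive real part on the line, which puts the poles of lower parameters to its
  left and those of upper parameters to its right. Hence the line is admissible itself, and any
  other admissible contour has every pole on the same side as the line.\<close>

lemma has_fox_H_vertical: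
  assumes "k1 \<le> length ls" "k2 \<le> length us"
    and lo: "\<And>x. x \<in> set (take k1 ls) \<Longrightarrow> \<exists>\<beta> B. x = (of_real \<beta>, B) \<and> B > 0 \<and> \<beta> + B * g > 0"
    and up: "\<And>x. x \<in> set (take k2 us) \<Longrightarrow> \<exists>\<beta> B. x = (of_real (1 - \<beta>), B) \<and> B > 0 \<and> \<beta> - B * g > 0"
    and decay: "strip_decay (fox_Xi k1 k2 us ls)"
    and int: "integrable lborel (\<lambda>y. fox_Xi k1 k2 us ls (Complex g y))"
    and z: "z > 0"
  shows "has_fox_H k1 k2 us ls z
    (of_real (z powr (- g) / (2 * pi)) * (CLBINT y. fox_Xi k1 k2 us ls (Complex g y) * cis (- (y * ln z))))"
proof -
  let ?X = "fox_Xi k1 k2 us ls"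
  let ?f = "\<lambda>s. ?X s * of_real z powr (- s)"
  \<comment> \<open>The numerator in the common form \<open>Gamma (\<beta> + B * s)\<close>. Taking
    real parts loses nothing, since \<open>lo\<close> and \<open>up\<close> make these parameters
    real.\<close>
  define Q where "Q = (\<lambda>x. (Re (fst x), snd x)) ` set (take k1 ls) \<union> (\<lambda>x. (1 - Re (fst x), - snd x)) ` set (take k2 us)"
  define P where "P = (\<Union>(\<beta>, B)\<in>Q. Gamma_pole_set \<beta> B)"
  have Q: "finite Q" "\<And>\<beta> B. (\<beta>, B) \<in> Q \<Longrightarrow> B \<noteq> 0"
    using lo up by (fastforce simp: Q_def)+
  have closed: "closed P"
    unfolding P_def using Q by (auto intro!: closed_UN closed_Gamma_pole_set)
  have real: "P \<subseteq> \<real>"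
    unfolding P_def using Q Gamma_pole_set_Reals by fast
  have fin: "finite {w \<in> P. \<bar>Re w\<bar> \<le> R}" for R
  proof -
    have "{w \<in> P. \<bar>Re w\<bar> \<le> R} = (\<Union>(\<beta>, B)\<in>Q. {w \<in> Gamma_pole_set \<beta> B. \<bar>Re w\<bar> \<le> R})"
      by (auto simp: P_def)
    then show ?thesis
      using Q finite_Gamma_pole_set_strip by auto
  qed
  have poles_lo: "is_pole (\<lambda>s. Gamma (fst x + of_real (snd x) * s)) w \<longleftrightarrow> w \<in> Gamma_pole_set (Re (fst x)) (snd x)"
      "w \<in> Gamma_pole_set (Re (fst x)) (snd x) \<Longrightarrow> Re w < g"
    if x: "x \<in> set (take k1 ls)" for x w
  proof -
    obtain \<beta> B where B: "x = (of_real \<beta>, B)" "B > 0" "\<beta> + B * g > 0"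
      using lo[OF x] by blast
    then show "is_pole (\<lambda>s. Gamma (fst x + of_real (snd x) * s)) w \<longleftrightarrow> w \<in> Gamma_pole_set (Re (fst x)) (snd x)"
      using is_pole_Gamma_affine_iff[of B \<beta> w] by simp
    assume "w \<in> Gamma_pole_set (Re (fst x)) (snd x)"
    then have "B * Re w \<le> - \<beta>"
      using Gamma_pole_set_Re[of w \<beta> B] B by auto
    then have "B * Re w < B * g"
      using B(3) by linarith
    then show "Re w < g"
      using B(2) by simp
  qed
  have poles_up: "is_pole (\<lambda>s. Gamma (1 - fst x - of_real (snd x) * s)) w \<longleftrightarrow> w \<in> Gamma_pole_set (1 - Re (fst x)) (- snd x)"
      "w \<in> Gamma_pole_set (1 - Re (fst x)) (- snd x) \<Longrightarrow> g < Re w"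
    if x: "x \<in> set (take k2 us)" for x w
  proof -
    obtain \<beta> B where B: "x = (of_real (1 - \<beta>), B)" "B > 0" "\<beta> - B * g > 0"
      using up[OF x] by blast
    then show "is_pole (\<lambda>s. Gamma (1 - fst x - of_real (snd x) * s)) w \<longleftrightarrow> w \<in> Gamma_pole_set (1 - Re (fst x)) (- snd x)"
      using is_pole_Gamma_affine_iff[of "- B" \<beta> w] by simp
    assume "w \<in> Gamma_pole_set (1 - Re (fst x)) (- snd x)"
    then have "- B * Re w \<le> - \<beta>"
      using Gamma_pole_set_Re[of w \<beta> "- B"] B by auto
    then have "B * g < B * Re w"
      using B(3) by linarith
    then show "g < Re w"
      using B(2) by simp
  qed
  have contour_iff: "fox_contour k1 k2 us ls C \<longleftrightarrow> (\<exists>\<gamma>. contour_from_to_ii_infinity \<gamma> C) \<and>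
      (\<forall>x\<in>set (take k1 ls). \<forall>w\<in>Gamma_pole_set (Re (fst x)) (snd x). left_of_contour C w) \<and>
      (\<forall>x\<in>set (take k2 us). \<forall>w\<in>Gamma_pole_set (1 - Re (fst x)) (- snd x). right_of_contour C w)" for C
    unfolding fox_contour_def
      all_nth_take[OF assms(1), of "\<lambda>x. \<forall>w. is_pole (\<lambda>s. Gamma (fst x + of_real (snd x) * s)) w \<longrightarrow> left_of_contour C w"]
      all_nth_take[OF assms(2), of "\<lambda>x. \<forall>w. is_pole (\<lambda>s. Gamma (1 - fst x - of_real (snd x) * s)) w \<longrightarrow> right_of_contour C w"]
    using poles_lo(1) poles_up(1) by (auto simp: Ball_def)
  have in_P: "(\<exists>x\<in>set (take k1 ls). w \<in> Gamma_pole_set (Re (fst x)) (snd x)) \<or>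
      (\<exists>x\<in>set (take k2 us). w \<in> Gamma_pole_set (1 - Re (fst x)) (- snd x))" if "w \<in> P" for w
    using that by (auto simp: P_def Q_def)
  have g_notin: "of_real g \<notin> P"
    using in_P[of "of_real g"] poles_lo(2) poles_up(2) by force
  have vertical: "fox_contour k1 k2 us ls (Complex g)"
    unfolding contour_iff
  proof (intro conjI ballI exI[of _ g] contour_from_to_ii_infinity_vertical)
    fix x w assume "x \<in> set (take k1 ls)" "w \<in> Gamma_pole_set (Re (fst x)) (snd x)"
    then show "left_of_contour (Complex g) w"
      using poles_lo(2) real by (intro left_of_vertical) (auto simp: P_def Q_def)
  next
    fix x w assume "x \<in> set (take k2 us)" "w \<in> Gamma_pole_set (1 - Re (fst x)) (- snd x)"
    then show "right_of_contour (Complex g) w"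
      using poles_up(2) real by (intro right_of_vertical) (auto simp: P_def Q_def)
  qed
  have "?X holomorphic_on - P"
  proof -
    have 1: "(\<lambda>s. Gamma (fst (ls ! j) + of_real (snd (ls ! j)) * s)) holomorphic_on - P" if "j < k1" for j
    proof -
      have x: "ls ! j \<in> set (take k1 ls)"
        using that assms(1) by (auto simp: in_set_conv_nth)
      then obtain \<beta> B where B: "ls ! j = (of_real \<beta>, B)"
        using lo by blast
      then have "Gamma_pole_set \<beta> B \<subseteq> P"
        using x by (force simp: P_def Q_def)
      then show ?thesis
        using holomorphic_Gamma_affine[of "- P" \<beta> B] B by auto
    qed
    have 2: "(\<lambda>s. Gamma (1 - fst (us ! j) - of_real (snd (us ! j)) * s)) holomorphic_on - P" if "j < k2" for j
    proof -
      have x: "us ! j \<in> set (take k2 us)"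
        using that assms(2) by (auto simp: in_set_conv_nth)
      then obtain \<beta> B where B: "us ! j = (of_real (1 - \<beta>), B)"
        using up by blast
      then have "Gamma_pole_set \<beta> (- B) \<subseteq> P"
        using x by (force simp: P_def Q_def)
      then show ?thesis
        using holomorphic_Gamma_affine[of "- P" \<beta> "- B"] B by auto
    qed
    show ?thesis
      \<comment> \<open>Since \<open>Gamma\<close> is 0 at its poles,
        \<open>inverse (Gamma z) = rGamma z\<close> holds everywhere. The denominator thus becomes
        entire, and only poles of the numerator have to be avoided.\<close>
      unfolding fox_Xi_def divide_inverse inverse_mult_distrib prod_inversef[symmetric] o_def rGamma_inverse_Gamma[symmetric]
      by (intro holomorphic_on_mult holomorphic_on_prod 1 2 holomorphic_rGamma' holomorphic_intros) auto
  qed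
  then have hol: "?f holomorphic_on - P"
    using z by (intro holomorphic_intros) auto
  have decay_f: "strip_decay ?f"
    by (intro strip_decay_mult strip_bounded_powr decay z)
  have f_line: "?f (Complex g y) = of_real (z powr (- g)) * (?X (Complex g y) * cis (- (y * ln z)))" for y
    using powr_Complex_eq_cis[OF z, of "- g" "- y"] by (simp add: mult_ac uminus_complex.code)
  have int_f: "integrable lborel (\<lambda>y. ?f (Complex g y))"
    unfolding f_line
  proof (intro integrable_mult_right Bochner_Integration.integrable_bound[OF int])
    have [measurable]: "(\<lambda>y. ?X (Complex g y)) \<in> borel_measurable lborel"
      using int by (rule borel_measurable_integrable)
    show "(\<lambda>y. ?X (Complex g y) * cis (- (y * ln z))) \<in> borel_measurable lborel"
      by measurable
  qed (simp add: norm_mult)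
  let ?L = "\<i> * (CLBINT y. ?f (Complex g y))"
  let ?h = "of_real (z powr (- g) / (2 * pi)) * (CLBINT y. ?X (Complex g y) * cis (- (y * ln z)))"
  \<comment> \<open>The \<open>\<i>\<close> from \<open>ds = \<i> dy\<close> cancels the one in the
    prefactor.\<close>
  have eq: "1 / (2 * of_real pi * \<i>) * ?L = ?h"
    unfolding f_line by simp
  have lim: "((\<lambda>p. contour_integral (C \<circ> linepath (fst p) (snd p)) ?f) \<longlongrightarrow> ?L) contour_ends"
    if C: "fox_contour k1 k2 us ls C" for C
  proof -
    obtain \<gamma> where \<gamma>: "contour_from_to_ii_infinity \<gamma> C"
      using C contour_iff by blast
    have side: "w \<notin> range C \<and> (\<exists>l.
      ((\<lambda>p. Re (winding_number (C \<circ> linepath (fst p) (snd p)) w)) \<longlongrightarrow> l) contour_ends \<and>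
      ((\<lambda>p. Re (winding_number (linepath (Complex g (fst p)) (Complex g (snd p))) w)) \<longlongrightarrow> l) contour_ends)"
      if "w \<in> P" for w
      using in_P[OF that]
    proof
      assume "\<exists>x\<in>set (take k1 ls). w \<in> Gamma_pole_set (Re (fst x)) (snd x)"
      then have "left_of_contour C w" "left_of_contour (Complex g) w"
        using C vertical unfolding contour_iff by auto
      then show ?thesis
        unfolding left_of_contour_iff vertical_linepath by auto
    next
      assume "\<exists>x\<in>set (take k2 us). w \<in> Gamma_pole_set (1 - Re (fst x)) (- snd x)"
      then have "right_of_contour C w" "right_of_contour (Complex g) w"
        using C vertical unfolding contour_iff by auto
      then show ?thesis
        unfolding right_of_contour_iff vertical_linepath by auto
    qed
    show ?thesis
    proof (rule contour_integral_shift[OF \<gamma> hol closed real])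
      show "\<exists>K. \<forall>s. \<bar>Re s\<bar> \<le> R \<longrightarrow> 1 \<le> \<bar>Im s\<bar> \<longrightarrow> norm (?f s) \<le> K / \<bar>Im s\<bar>" for R
        using decay_f unfolding strip_decay_def by blast
    qed (use side g_notin fin contour_integral_vertical_tendsto[OF int_f] in auto)
  qed
  show ?thesis
    unfolding has_fox_H_def case_prod_unfold
  proof (intro conjI exI[of _ "Complex g"] vertical allI impI)
    fix C assume "fox_contour k1 k2 us ls C"
    from tendsto_mult_left[OF lim[OF this], of "1 / (2 * of_real pi * \<i>)"]
    show "((\<lambda>p. 1 / (2 * of_real pi * \<i>) * contour_integral (C \<circ> linepath (fst p) (snd p)) ?f) \<longlongrightarrow> ?h) contour_ends"
      by (simp only: eq)
  qed
qed

text \<open>\<open>has_fox_H\<close> provides an admissible contour, and the limit along it is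
  unique because the filter is nontrivial.\<close>

lemma fox_H_eqI:
  assumes "has_fox_H k1 k2 us ls z h"
  shows "fox_H k1 k2 us ls z = h"
  unfolding fox_H_def
proof (rule the_equality[of "\<lambda>h. has_fox_H k1 k2 us ls z h", OF assms])
  fix h' assume "has_fox_H k1 k2 us ls z h'"
  with assms show "h' = h"
    unfolding has_fox_H_def using tendsto_unique[OF contour_ends_neq_bot] by blast
qed

section \<open>Choice of the abscissa and assembly of the factors\<close>

lemma exists_abscissa:
  fixes f :: "'a \<Rightarrow> real"
  assumes "finite J" "\<And>j. j \<in> J \<Longrightarrow> f j > 0"
  obtains g where "g > 0" "\<And>j. j \<in> J \<Longrightarrow> g < f j"
proof -
  have "\<exists>g>0. \<forall>j\<in>J. g < f j"
    using assms
  proof (induction J)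
    case empty
    show ?case by (auto intro: exI[of _ 1])
  next
    case (insert j J)
    then obtain g where "g > 0" "\<forall>j\<in>J. g < f j" by auto
    then show ?case
      using insert.prems[of j] by (intro exI[of _ "min g (f j / 2)"]) (auto simp: min_less_iff_disj)
  qed
  then show ?thesis using that by blast
qed

theorem theorem4p3:
  fixes n1 n2 n3 n4 m n :: nat
    and a b a' c d a'' r ov a''' v w :: "nat \<Rightarrow> real"
    and us ls :: "(complex \<times> real) list"
  assumes "n1 \<ge> 1 \<or> n3 \<ge> 1"
    and "\<And>j. j \<in> {1..n1} \<Longrightarrow> a j > 0 \<and> b j \<ge> 0"
    and "\<And>j. j \<in> {1..n2} \<Longrightarrow> a' j > 0 \<and> c j \<ge> 0 \<and> d j \<ge> c j + 1"
    and "\<And>j. j \<in> {1..n3} \<Longrightarrow> a'' j > 0 \<and> r j > 0 \<and> ov j \<ge> 0"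
    and "\<And>j. j \<in> {1..n4} \<Longrightarrow> a''' j > 0 \<and> v j > 0 \<and> w j \<ge> v j + 1"
    and "m = n1 + n2 + n3"
    and "n = n3 + n4"
    and "us = map (\<lambda>j. (of_real (1 - r j), a'' j)) [1..<Suc n3] @
              map (\<lambda>j. (of_real (1 - v j), a''' j)) [1..<Suc n4] @
              map (\<lambda>j. (of_real (d j), a' j)) [1..<Suc n2]"
    and "ls = map (\<lambda>j. (of_real (b j), a j)) [1..<Suc n1] @
              map (\<lambda>j. (of_real (c j), a' j)) [1..<Suc n2] @
              map (\<lambda>j. (of_real (ov j), a'' j)) [1..<Suc n3] @
              map (\<lambda>j. (of_real (1 - w j), a''' j)) [1..<Suc n4]"
    and "\<And>j j' l l'. j < n \<Longrightarrow> j' < m \<Longrightarrow>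
           of_real (snd (us ! j)) * (fst (ls ! j') + of_nat l) \<noteq>
           of_real (snd (ls ! j')) * (fst (us ! j) - of_nat l' - 1)"
  shows "\<forall>t>0. fox_H m n us ls t \<in> \<real> \<and> Re (fox_H m n us ls t) > 0"
proof -
  \<comment> \<open>The leftmost poles of the upper Gamma factors are at \<open>r j / a'' j\<close>
    and \<open>v j / a''' j\<close>, so the abscissa stays below these. Any positive abscissa is to
    the right of the poles from lower parameters, because \<open>b\<close>, \<open>c\<close> and
    \<open>ov\<close> are nonnegative.\<close>
  obtain g3 where g3: "g3 > 0" "\<And>j. j \<in> {1..n3} \<Longrightarrow> g3 < r j / a'' j"
    using exists_abscissa[of "{1..n3}" "\<lambda>j. r j / a'' j"] assms(4) by auto
  obtain g4 where g4: "g4 > 0" "\<And>j. j \<in> {1..n4} \<Longrightarrow> g4 < v j / a''' j"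
    using exists_abscissa[of "{1..n4}" "\<lambda>j. v j / a''' j"] assms(5) by auto
  define g where "g = min g3 g4"
  have g: "g > 0" using g3 g4 by (simp add: g_def)
  have pos1: "a j > 0" "b j + a j * g > 0" if "j \<in> {1..n1}" for j
    using assms(2)[OF that] g by (auto intro: add_nonneg_pos)
  have pos2: "a' j > 0" "c j + a' j * g > 0" "d j - c j > 0" if "j \<in> {1..n2}" for j
    using assms(3)[OF that] g by (auto intro: add_nonneg_pos)
  have pos3: "a'' j > 0" "ov j + a'' j * g > 0" "r j + (- a'' j) * g > 0" if "j \<in> {1..n3}" for j
  proof -
    have "a'' j > 0" "ov j \<ge> 0" using assms(4)[OF that] by auto
    moreover have "g < r j / a'' j" using g3(2)[OF that] by (simp add: g_def)
    ultimately show "a'' j > 0" "ov j + a'' j * g > 0" "r j + (- a'' j) * g > 0"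
      using g by (simp_all add: field_simps add_nonneg_pos)
  qed
  have pos4: "a''' j > 0" "v j + (- a''' j) * g > 0" "w j - v j > 0" if "j \<in> {1..n4}" for j
  proof -
    have "a''' j > 0" "w j \<ge> v j + 1" using assms(5)[OF that] by auto
    moreover have "g < v j / a''' j" using g4(2)[OF that] by (simp add: g_def)
    ultimately show "a''' j > 0" "v j + (- a''' j) * g > 0" "w j - v j > 0"
      by (simp_all add: field_simps)
  qed

  \<comment> \<open>Factors are grouped by their scales: \<open>c\<close> in the numerator is paired
    with \<open>d\<close> in the denominator, \<open>v\<close> likewise with \<open>w\<close>, while
    \<open>ov\<close> and \<open>r\<close> both belong to the numerator. Sums such as
    \<open>c j + (d j - c j)\<close> and slopes such as \<open>- a'' j\<close> literally match the
    lemmas on Gamma factors, with \<open>\<delta> = d j - c j\<close>.\<close>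
  define F1 where "F1 j s = Gamma (of_real (b j) + of_real (a j) * s)" for j :: nat and s :: complex
  define F2 where "F2 j s = Gamma (of_real (c j) + of_real (a' j) * s) *
    rGamma (of_real (c j + (d j - c j)) + of_real (a' j) * s)" for j :: nat and s :: complex
  define F3 where "F3 j s = Gamma (of_real (ov j) + of_real (a'' j) * s) *
    Gamma (of_real (r j) + of_real (- a'' j) * s)" for j :: nat and s :: complex
  define F4 where "F4 j s = Gamma (of_real (v j) + of_real (- a''' j) * s) *
    rGamma (of_real (v j + (w j - v j)) + of_real (- a''' j) * s)" for j :: nat and s :: complex

  have lens: "m \<le> length ls" "n \<le> length us"
    using assms(6-9) by simp_all
  have ls: "take m ls = map (\<lambda>j. (of_real (b j), a j)) [1..<Suc n1] @
              map (\<lambda>j. (of_real (c j), a' j)) [1..<Suc n2] @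
              map (\<lambda>j. (of_real (ov j), a'' j)) [1..<Suc n3]"
      "drop m ls = map (\<lambda>j. (of_real (1 - w j), a''' j)) [1..<Suc n4]"
    unfolding assms(6,9) by (simp_all del: upt_Suc)
  have us: "take n us = map (\<lambda>j. (of_real (1 - r j), a'' j)) [1..<Suc n3] @
              map (\<lambda>j. (of_real (1 - v j), a''' j)) [1..<Suc n4]"
      "drop n us = map (\<lambda>j. (of_real (d j), a' j)) [1..<Suc n2]"
    unfolding assms(7,8) by (simp_all del: upt_Suc)
  have Xi: "fox_Xi m n us ls s =
      (\<Prod>j\<in>{1..n1}. F1 j s) * (\<Prod>j\<in>{1..n2}. F2 j s) * (\<Prod>j\<in>{1..n3}. F3 j s) * (\<Prod>j\<in>{1..n4}. F4 j s)" for s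
    unfolding fox_Xi_def
      prod_nth_take[OF lens(1), of "\<lambda>x. Gamma (fst x + of_real (snd x) * s)"]
      prod_nth_take[OF lens(2), of "\<lambda>x. Gamma (1 - fst x - of_real (snd x) * s)"]
      prod_nth_drop[of "\<lambda>x. Gamma (1 - fst x - of_real (snd x) * s)"]
      prod_nth_drop[of "\<lambda>x. Gamma (fst x + of_real (snd x) * s)"]
      ls us map_append map_map prod_list.append prod_list_map_upt F1_def F2_def F3_def F4_def
    by (simp add: o_def prod.distrib rGamma_inverse_Gamma prod_inversef[unfolded o_def] divide_inverse mult_ac)

  have mult2: "fourier_multiplier (\<lambda>y. \<Prod>j\<in>{1..n2}. F2 j (Complex g y))"
    unfolding F2_def by (intro fourier_multiplier_prod fourier_multiplier_Gamma_ratio pos2)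
  have mult3: "fourier_multiplier (\<lambda>y. F3 j (Complex g y))" if "j \<in> {1..n3}" for j
    unfolding F3_def using that by (intro fourier_multiplier_mult fourier_multiplier_Gamma pos3)
  have mult4: "fourier_multiplier (\<lambda>y. \<Prod>j\<in>{1..n4}. F4 j (Complex g y))"
    unfolding F4_def by (intro fourier_multiplier_prod fourier_multiplier_Gamma_ratio pos4)
  have fp: "fourier_pos (\<lambda>y. fox_Xi m n us ls (Complex g y))"
  proof (cases "n1 \<ge> 1")
    case True
    then have "fourier_pos (\<lambda>y. \<Prod>j\<in>{1..n1}. F1 j (Complex g y))"
      unfolding F1_def
      by (intro fourier_pos_prod[of _ 1] fourier_pos_Gamma_line fourier_multiplier_Gamma pos1) auto
    then show ?thesis
      unfolding Xi using mult2 fourier_multiplier_prod[of "{1..n3}", OF mult3] mult4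
      by (simp add: fourier_multiplier_def)
  next
    case False
    then have one: "1 \<in> {1..n3}" using assms(1) by auto
    \<comment> \<open>The starting factor needs a positive slope, so it is the one with
      \<open>ov 1\<close>; its partner with slope \<open>- a'' 1\<close> acts as a
      multiplier.\<close>
    have "fourier_pos (\<lambda>y. F3 1 (Complex g y))"
      using fourier_pos_Gamma_line[OF pos3(2,1)[OF one]] fourier_multiplier_Gamma[OF pos3(3)[OF one]]
      unfolding F3_def fourier_multiplier_def by blast
    then have "fourier_pos (\<lambda>y. \<Prod>j\<in>{1..n3}. F3 j (Complex g y))"
      using one mult3 by (intro fourier_pos_prod) auto
    then have "fourier_pos (\<lambda>y. (\<Prod>j\<in>{1..n3}. F3 j (Complex g y)) *
        (\<Prod>j\<in>{1..n2}. F2 j (Complex g y)) * (\<Prod>j\<in>{1..n4}. F4 j (Complex g y)))"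
      using mult2 mult4 by (simp add: fourier_multiplier_def)
    then show ?thesis
      using False unfolding Xi by (simp add: mult_ac)
  qed

  have dec1: "strip_decay (F1 j)" if "j \<in> {1..n1}" for j
    unfolding F1_def[abs_def] using pos1(1)[OF that] by (intro strip_decay_Gamma) auto
  have bnd2: "strip_bounded (F2 j)" if "j \<in> {1..n2}" for j
    unfolding F2_def[abs_def] using pos2[OF that] by (intro strip_bounded_Gamma_ratio) auto
  have dec3: "strip_decay (F3 j)" if "j \<in> {1..n3}" for j
    unfolding F3_def[abs_def] using pos3(1)[OF that]
    by (intro strip_decay_mult strip_decay_imp_bounded strip_decay_Gamma) auto
  have bnd4: "strip_bounded (F4 j)" if "j \<in> {1..n4}" for j
    unfolding F4_def[abs_def] using pos4[OF that] by (intro strip_bounded_Gamma_ratio) auto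
  \<comment> \<open>The quotients are only known to be bounded, so the decay comes from
    \<open>F1\<close> or, if \<open>n1 = 0\<close>, from \<open>F3\<close>.\<close>
  have dec: "strip_decay (\<lambda>s. fox_Xi m n us ls s)"
  proof (cases "n1 \<ge> 1")
    case True
    then show ?thesis
      unfolding Xi
      by (intro strip_decay_mult strip_decay_prod[of _ 1] strip_bounded_prod strip_decay_imp_bounded[OF dec3] dec1 bnd2 bnd4) auto
  next
    case False
    then have "strip_decay (\<lambda>s. (\<Prod>j\<in>{1..n3}. F3 j s) * (\<Prod>j\<in>{1..n2}. F2 j s) * (\<Prod>j\<in>{1..n4}. F4 j s))"
      using assms(1)
      by (intro strip_decay_mult strip_decay_prod[of _ 1] strip_bounded_prod dec3 bnd2 bnd4) auto
    then show ?thesis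
      using False unfolding Xi by (simp add: mult_ac)
  qed

  show ?thesis
  proof (intro allI impI)
    fix t :: real assume t: "t > 0"
    let ?I = "CLBINT y. fox_Xi m n us ls (Complex g y) * cis (- (y * ln t))"
    have "fox_H m n us ls t = of_real (t powr (- g) / (2 * pi)) * ?I"
    proof (intro fox_H_eqI has_fox_H_vertical lens dec t)
      show "\<exists>\<beta> B. x = (of_real \<beta>, B) \<and> B > 0 \<and> \<beta> + B * g > 0" if "x \<in> set (take m ls)" for x
        using that pos1 pos2 pos3 unfolding ls by fastforce
      show "\<exists>\<beta> B. x = (of_real (1 - \<beta>), B) \<and> B > 0 \<and> \<beta> - B * g > 0" if "x \<in> set (take n us)" for x
        using that pos3 pos4 unfolding us by fastforce
      show "integrable lborel (\<lambda>y. fox_Xi m n us ls (Complex g y))"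
        using fp by (simp add: fourier_pos_def)
    qed
    moreover have "?I \<in> \<real>" "Re ?I > 0"
      using fp by (auto simp: fourier_pos_def)
    ultimately show "fox_H m n us ls t \<in> \<real> \<and> Re (fox_H m n us ls t) > 0"
      using t by (auto elim!: Reals_cases)
  qed
qed

end
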